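(* If a Berge graph $G$ admits a loose skew partition, then $G$ admits a balanced skew partition.
   Context: Graphs are finite and simple; Berge means every hole (induced cycle of length $\ge4$) and every antihole (induced subgraph whose complement is a hole) has even length. A path/antipath means an induced subgraph that is a path / whose complement is a path; length counts edges (of the complement for antipaths). $X$ is connected if $G|X$ is connected, anticonnected if $\overline G|X$ is connected; a component of a nonempty set $A$ is a maximal connected subset of $A$, an anticomponent a maximal anticonnected subset. A skew partition is a partition $(A,B)$ of $V(G)$ with $A$ not connected and $B$ not anticonnected. It is loose if either some vertex of $B$ has no neighbour in some component of $A$, or some vertex of $A$ is adjacent to every vertex of some anticomponent of $B$. It is balanced if there is no odd path between nonadjacent vertices of $B$ with interior in $A$ and no odd antipath between adjacent vertices of $A$ with interior in $B$. *)

theory Defs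
  imports Main
begin

definition simple_graph :: "'a set \<Rightarrow> ('a \<Rightarrow> 'a \<Rightarrow> bool) \<Rightarrow> bool" where
  "simple_graph V E \<longleftrightarrow> finite V \<and> (\<forall>u v. E u v \<longrightarrow> E v u)
     \<and> (\<forall>v. \<not> E v v) \<and> (\<forall>u v. E u v \<longrightarrow> u \<in> V \<and> v \<in> V)"

definition coadj :: "('a \<Rightarrow> 'a \<Rightarrow> bool) \<Rightarrow> 'a \<Rightarrow> 'a \<Rightarrow> bool" where
  "coadj E u v \<longleftrightarrow> u \<noteq> v \<and> \<not> E u v"

definition ind_path :: "('a \<Rightarrow> 'a \<Rightarrow> bool) \<Rightarrow> 'a list \<Rightarrow> bool" where
  "ind_path R xs \<longleftrightarrow> xs \<noteq> [] \<and> distinct xs \<and>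
     (\<forall>i<length xs. \<forall>j<length xs. R (xs!i) (xs!j) \<longleftrightarrow> (i = Suc j \<or> j = Suc i))"

definition ind_hole :: "('a \<Rightarrow> 'a \<Rightarrow> bool) \<Rightarrow> 'a list \<Rightarrow> bool" where
  "ind_hole R xs \<longleftrightarrow> length xs \<ge> 4 \<and> distinct xs \<and>
     (\<forall>i<length xs. \<forall>j<length xs. R (xs!i) (xs!j) \<longleftrightarrow>
        (Suc i mod length xs = j \<or> Suc j mod length xs = i))"

definition berge :: "'a set \<Rightarrow> ('a \<Rightarrow> 'a \<Rightarrow> bool) \<Rightarrow> bool" where
  "berge V E \<longleftrightarrow> (\<forall>xs. set xs \<subseteq> V \<longrightarrow>
     (ind_hole E xs \<longrightarrow> even (length xs)) \<and> (ind_hole (coadj E) xs \<longrightarrow> even (length xs)))"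

text \<open>X is connected w.r.t. R if any two vertices of X are joined by an R-walk inside X
  (so the empty set counts as connected; "not connected" means at least two components).\<close>
definition conn :: "('a \<Rightarrow> 'a \<Rightarrow> bool) \<Rightarrow> 'a set \<Rightarrow> bool" where
  "conn R X \<longleftrightarrow> (\<forall>x\<in>X. \<forall>y\<in>X. (\<lambda>u v. u \<in> X \<and> v \<in> X \<and> R u v)\<^sup>*\<^sup>* x y)"

definition component_of :: "('a \<Rightarrow> 'a \<Rightarrow> bool) \<Rightarrow> 'a set \<Rightarrow> 'a set \<Rightarrow> bool" where
  "component_of R A C \<longleftrightarrow> C \<noteq> {} \<and> C \<subseteq> A \<and> conn R C \<and>
     (\<forall>D. C \<subseteq> D \<and> D \<subseteq> A \<and> conn R D \<longrightarrow> D = C)"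

definition skew_partition :: "'a set \<Rightarrow> ('a \<Rightarrow> 'a \<Rightarrow> bool) \<Rightarrow> 'a set \<Rightarrow> 'a set \<Rightarrow> bool" where
  "skew_partition V E A B \<longleftrightarrow> A \<union> B = V \<and> A \<inter> B = {} \<and>
     \<not> conn E A \<and> \<not> conn (coadj E) B"

definition loose :: "'a set \<Rightarrow> ('a \<Rightarrow> 'a \<Rightarrow> bool) \<Rightarrow> 'a set \<Rightarrow> 'a set \<Rightarrow> bool" where
  "loose V E A B \<longleftrightarrow>
     (\<exists>b\<in>B. \<exists>C. component_of E A C \<and> (\<forall>c\<in>C. \<not> E b c)) \<or>
     (\<exists>a\<in>A. \<exists>K. component_of (coadj E) B K \<and> (\<forall>k\<in>K. E a k))"

definition balanced :: "'a set \<Rightarrow> ('a \<Rightarrow> 'a \<Rightarrow> bool) \<Rightarrow> 'a set \<Rightarrow> 'a set \<Rightarrow> bool" where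
  "balanced V E A B \<longleftrightarrow>
     \<not> (\<exists>xs. set xs \<subseteq> V \<and> ind_path E xs \<and> length xs \<ge> 2 \<and>
          hd xs \<in> B \<and> last xs \<in> B \<and> \<not> E (hd xs) (last xs) \<and>
          set (butlast (tl xs)) \<subseteq> A \<and> odd (length xs - 1)) \<and>
     \<not> (\<exists>xs. set xs \<subseteq> V \<and> ind_path (coadj E) xs \<and> length xs \<ge> 2 \<and>
          hd xs \<in> A \<and> last xs \<in> A \<and> E (hd xs) (last xs) \<and>
          set (butlast (tl xs)) \<subseteq> B \<and> odd (length xs - 1))"

end

theory Submission
  imports Defs
begin

text \<open>
  Among all skew partitions \<open>(A, B)\<close> with a component \<open>C\<close> of \<open>A\<close> and an anticomponent \<open>K\<close> of \<open>B\<close> such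
  that some vertex of \<open>K\<close> has no neighbour in \<open>C\<close> (one exists up to complementation), take one that
  minimises \<open>|B| - 2|K|\<close>. If \<open>A\<close> has an isolated vertex, or \<open>B\<close> a vertex complete to the rest of \<open>B\<close>,
  a balanced skew partition is built around the neighbourhood of that vertex. Otherwise moving a
  single vertex between \<open>A\<close> and \<open>B\<close> yields another skew partition, so minimality forces every vertex
  of \<open>B - K\<close> to have a neighbour in \<open>C\<close>, and every vertex of \<open>A - C\<close> complete to another
  anticomponent \<open>L\<close> to be complete to \<open>K\<close>. Balance then spreads from \<open>(C, B - K)\<close>, where the vertex
  missing \<open>C\<close> witnesses it, to \<open>(A - C, B - K)\<close>, to \<open>(A - C, K)\<close> and to \<open>(C, K)\<close>.

  The spreading step along an anticonnected set \<open>X\<close> needs a form of the Roussel--Rubio lemma: in a Berge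
  graph an odd path with \<open>X\<close>-complete ends has an odd number of \<open>X\<close>-complete edges, provided its
  interior and \<open>X\<close> form a balanced pair. The balance hypothesis excludes leaps, so that only parity
  arguments remain.
\<close>

section \<open>Induced paths and holes\<close>

lemma coadj_coadj: "(\<And>v. \<not> R v v) \<Longrightarrow> coadj (coadj R) = R"
  unfolding coadj_def by (intro ext) auto

lemma ind_path_iff_nth:
  "ind_path R xs \<Longrightarrow> i < length xs \<Longrightarrow> j < length xs \<Longrightarrow> R (xs!i) (xs!j) \<longleftrightarrow> i = Suc j \<or> j = Suc i"
  unfolding ind_path_def by blast

lemma ind_path_distinct: "ind_path R xs \<Longrightarrow> distinct xs"
  unfolding ind_path_def by blast

lemma ind_path_segment:
  assumes "ind_path R xs" "i < length xs" "0 < k"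
  shows "ind_path R (take k (drop i xs))"
  using assms unfolding ind_path_def by auto

lemma ind_path_prefix: "ind_path R (xs @ ys) \<Longrightarrow> xs \<noteq> [] \<Longrightarrow> ind_path R xs"
  using ind_path_segment[of R "xs @ ys" 0 "length xs"] by simp

lemma ind_path_suffix: "ind_path R (xs @ ys) \<Longrightarrow> ys \<noteq> [] \<Longrightarrow> ind_path R ys"
  using ind_path_segment[of R "xs @ ys" "length xs" "length ys"] by simp

lemma ind_path_rev:
  assumes "ind_path R xs" shows "ind_path R (rev xs)"
  unfolding ind_path_def
proof (intro conjI allI impI)
  show "rev xs \<noteq> []" "distinct (rev xs)"
    using assms unfolding ind_path_def by auto
next
  fix i j assume "i < length (rev xs)" "j < length (rev xs)"
  then show "R (rev xs ! i) (rev xs ! j) \<longleftrightarrow> i = Suc j \<or> j = Suc i"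
    using ind_path_iff_nth[OF assms, of "length xs - Suc i" "length xs - Suc j"]
    by (auto simp: rev_nth)
qed

lemma nth_eq_last_iff:
  "distinct xs \<Longrightarrow> i < length xs \<Longrightarrow> xs ! i = last xs \<longleftrightarrow> Suc i = length xs"
  by (cases "xs = []") (auto simp: last_conv_nth nth_eq_iff_index_eq)

lemma nth_eq_hd_iff:
  "distinct xs \<Longrightarrow> i < length xs \<Longrightarrow> xs ! i = hd xs \<longleftrightarrow> i = 0"
  by (cases "xs = []") (auto simp: hd_conv_nth nth_eq_iff_index_eq)

lemma Suc_mod_eq: "i < n \<Longrightarrow> Suc i mod n = (if Suc i = n then 0 else Suc i)"
  by auto

lemma ind_path_pair: "ind_path R [u, v] \<Longrightarrow> R u v"
  using ind_path_iff_nth[of R "[u,v]" 0 1] by simp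

lemma list_two_ends:
  assumes "xs \<noteq> []" "hd xs \<noteq> last xs"
  obtains ys where "xs = hd xs # ys @ [last xs]"
  using assms by (metis append_butlast_last_id last_ConsL last_ConsR list.collapse list.sel(1))

locale adjacency =
  fixes R :: "'a \<Rightarrow> 'a \<Rightarrow> bool"
  assumes sym: "R u v \<Longrightarrow> R v u" and irrefl: "\<not> R v v"
begin

lemma ind_path_append:
  assumes "ind_path R xs" "ind_path R ys" "set xs \<inter> set ys = {}"
    and cross: "\<And>x y. x \<in> set xs \<Longrightarrow> y \<in> set ys \<Longrightarrow> R x y \<longleftrightarrow> x = last xs \<and> y = hd ys"
  shows "ind_path R (xs @ ys)"
  unfolding ind_path_def
proof (intro conjI allI impI)
  show "xs @ ys \<noteq> []" "distinct (xs @ ys)"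
    using assms unfolding ind_path_def by auto
next
  have d: "distinct xs" "distinct ys" using assms by (auto dest: ind_path_distinct)
  have c: "R (xs!i) (ys!j) \<longleftrightarrow> Suc i = length xs \<and> j = 0" if "i < length xs" "j < length ys" for i j
    using that cross[of "xs!i" "ys!j"] nth_eq_last_iff[OF d(1), of i] nth_eq_hd_iff[OF d(2), of j] by simp
  fix i j assume ij: "i < length (xs @ ys)" "j < length (xs @ ys)"
  let ?m = "length xs" and ?n = "length ys"
  consider "i < ?m" "j < ?m" | j' where "i < ?m" "j = ?m + j'" "j' < ?n"
    | i' where "i = ?m + i'" "i' < ?n" "j < ?m"
    | i' j' where "i = ?m + i'" "i' < ?n" "j = ?m + j'" "j' < ?n"
    using ij unfolding length_append by (metis add_diff_inverse_nat add_less_cancel_left)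
  then show "R ((xs @ ys) ! i) ((xs @ ys) ! j) \<longleftrightarrow> i = Suc j \<or> j = Suc i"
  proof cases
    case 1
    then show ?thesis using ind_path_iff_nth[OF assms(1)] by (simp add: nth_append)
  next
    case 2
    then show ?thesis using c[of i j'] by (simp add: nth_append) linarith
  next
    case 3
    have "R (ys ! i') (xs ! j) \<longleftrightarrow> R (xs ! j) (ys ! i')"
      using sym by blast
    then show ?thesis using 3 c[of j i'] by (simp add: nth_append) linarith
  next
    case 4
    then show ?thesis using ind_path_iff_nth[OF assms(2), of i' j'] by (simp add: nth_append)
  qed
qed

lemma ind_path_singleton: "ind_path R [u]"
  using irrefl unfolding ind_path_def by auto

text \<open>\<open>length xs \<ge> 3\<close> keeps the two ends of \<open>xs\<close> nonadjacent and
  the total length at least 4, so \<open>ys\<close> may be a single vertex adjacent to both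
  ends.\<close>

lemma ind_hole_append:
  assumes "ind_path R xs" "ind_path R ys" "set xs \<inter> set ys = {}" "length xs \<ge> 3" 
    and cross: "\<And>x y. x \<in> set xs \<Longrightarrow> y \<in> set ys \<Longrightarrow>
      R x y \<longleftrightarrow> x = last xs \<and> y = hd ys \<or> x = hd xs \<and> y = last ys"
  shows "ind_hole R (xs @ ys)"
  unfolding ind_hole_def
proof (intro conjI allI impI)
  have ne: "length ys > 0" using assms unfolding ind_path_def by auto
  show "length (xs @ ys) \<ge> 4" using assms(4) ne unfolding length_append by linarith
  show "distinct (xs @ ys)" using assms unfolding ind_path_def by auto
  have d: "distinct xs" "distinct ys" using assms by (auto dest: ind_path_distinct)
  have c: "R (xs!i) (ys!j) \<longleftrightarrow> Suc i = length xs \<and> j = 0 \<or> i = 0 \<and> Suc j = length ys"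
    if "i < length xs" "j < length ys" for i j
    using that cross[of "xs!i" "ys!j"] nth_eq_last_iff[OF d(1), of i] nth_eq_hd_iff[OF d(2), of j]
      nth_eq_last_iff[OF d(2), of j] nth_eq_hd_iff[OF d(1), of i] by simp
  fix i j assume ij: "i < length (xs @ ys)" "j < length (xs @ ys)"
  let ?m = "length xs" and ?n = "length ys"
  have mn: "?m \<ge> 3" "?n > 0" using assms(4) ne by auto
  consider "i < ?m" "j < ?m" | j' where "i < ?m" "j = ?m + j'" "j' < ?n"
    | i' where "i = ?m + i'" "i' < ?n" "j < ?m"
    | i' j' where "i = ?m + i'" "i' < ?n" "j = ?m + j'" "j' < ?n"
    using ij unfolding length_append by (metis add_diff_inverse_nat add_less_cancel_left)
  then have "R ((xs @ ys) ! i) ((xs @ ys) ! j) \<longleftrightarrow>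
      (Suc i = ?m + ?n \<and> j = 0 \<or> Suc i = j) \<or> (Suc j = ?m + ?n \<and> i = 0 \<or> Suc j = i)"
  proof cases
    case 1
    have "Suc i < ?m + ?n" "Suc j < ?m + ?n" using 1 mn by linarith+
    then show ?thesis using ind_path_iff_nth[OF assms(1) 1] 1 by (auto simp: nth_append)
  next
    case 2
    then show ?thesis using c[of i j'] mn by (simp add: nth_append) linarith
  next
    case 3
    have "R (ys ! i') (xs ! j) \<longleftrightarrow> R (xs ! j) (ys ! i')"
      using sym by blast
    then show ?thesis using 3 c[of j i'] mn by (simp add: nth_append) linarith
  next
    case 4
    then show ?thesis using ind_path_iff_nth[OF assms(2), of i' j'] mn by (auto simp: nth_append)
  qed
  then show "R ((xs @ ys) ! i) ((xs @ ys) ! j) \<longleftrightarrow>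
      Suc i mod length (xs @ ys) = j \<or> Suc j mod length (xs @ ys) = i"
    using ij by (simp add: Suc_mod_eq)
qed

text \<open>The second path is walked backwards. Nonadjacent ends force both interiors to be
  nonempty, so the cycle has \<open>length ys + length zs + 2 \<ge> 4\<close> vertices.\<close>

lemma ind_hole_two_paths:
  assumes p: "ind_path R (u # ys @ [v])" "ind_path R (u # zs @ [v])" "\<not> R u v"
    and cross: "\<And>y z. y \<in> set ys \<Longrightarrow> z \<in> set zs \<Longrightarrow> y \<noteq> z \<and> \<not> R y z"
  shows "ind_hole R ((u # ys @ [v]) @ rev zs)"
proof (rule ind_hole_append[OF p(1)])
  have uv: "u \<noteq> v" using p(1) by (auto dest: ind_path_distinct)
  have ne: "zs \<noteq> []" "ys \<noteq> []"
    using p ind_path_pair[of R u v] by auto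
  have zp: "ind_path R zs" 
    using ind_path_prefix[OF ind_path_suffix[of R "[u]" "zs @ [v]"]] p(2) ne by simp
  show "ind_path R (rev zs)" by (rule ind_path_rev[OF zp])
  have dz: "distinct (u # zs @ [v])" using p(2) by (rule ind_path_distinct)
  show "set (u # ys @ [v]) \<inter> set (rev zs) = {}"
    using dz cross by auto
  show "length (u # ys @ [v]) \<ge> 3" using ne by (cases ys) auto
  have uz: "R u z \<longleftrightarrow> z = hd zs" if "z \<in> set zs" for z
  proof -
    obtain k where k: "k < length zs" "z = zs ! k" using \<open>z \<in> set zs\<close> by (auto simp: in_set_conv_nth)
    have "R u z \<longleftrightarrow> k = 0"
      using ind_path_iff_nth[OF p(2), of 0 "Suc k"] k by (simp add: nth_append)
    then show ?thesis using k nth_eq_hd_iff[of zs k] dz by auto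
  qed
  have vz: "R v z \<longleftrightarrow> z = last zs" if "z \<in> set zs" for z
  proof -
    obtain k where k: "k < length zs" "z = zs ! k" using \<open>z \<in> set zs\<close> by (auto simp: in_set_conv_nth)
    have "R v z \<longleftrightarrow> Suc k = length zs"
      using ind_path_iff_nth[OF p(2), of "Suc (length zs)" "Suc k"] k by (auto simp add: nth_append)
    then show ?thesis using k nth_eq_last_iff[of zs k] dz by auto
  qed
  fix x y assume x: "x \<in> set (u # ys @ [v])" and y: "y \<in> set (rev zs)"
  have u: "u \<notin> set ys" "v \<notin> set ys" using p(1) by (auto dest: ind_path_distinct)
  consider "x = u" | "x = v" | "x \<in> set ys" using x by auto
  then show "R x y \<longleftrightarrow> x = last (u # ys @ [v]) \<and> y = hd (rev zs) \<or> x = hd (u # ys @ [v]) \<and> y = last (rev zs)"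
    by cases (use x y uz vz uv u cross ne in \<open>auto simp: hd_rev last_rev\<close>)
qed

lemma ind_path_three:
  assumes "u \<noteq> v" "R u w" "R w v" "\<not> R u v"
  shows "ind_path R [u, w, v]"
proof -
  have "w \<noteq> v" "w \<noteq> u" using assms irrefl by blast+
  then have "ind_path R ([w] @ [v])"
    using assms by (intro ind_path_append ind_path_singleton) auto
  then have "ind_path R ([u] @ ([w] @ [v]))"
    using assms \<open>w \<noteq> u\<close> by (intro ind_path_append ind_path_singleton) auto
  then show ?thesis by simp
qed

lemma ind_path_four:
  assumes "distinct [a, b, c, d]" "R a b" "R b c" "R c d" "\<not> R a c" "\<not> R b d" "\<not> R a d"
  shows "ind_path R [a, b, c, d]"
proof -
  have "ind_path R [b, c, d]" using assms by (intro ind_path_three) auto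
  then have "ind_path R ([a] @ [b, c, d])"
    using assms by (intro ind_path_append ind_path_singleton) auto
  then show ?thesis by simp
qed

text \<open>Induction along a walk from \<open>a\<close> to \<open>b\<close>: when the walk reaches
  a new vertex, the induced path is cut at its first vertex adjacent to it and extended; when the
  walk returns to the path, the path is cut there.\<close>

lemma conn_induced_path:
  assumes "conn R X" "a \<in> X" "b \<in> X"
  shows "\<exists>xs. ind_path R xs \<and> hd xs = a \<and> last xs = b \<and> set xs \<subseteq> X"
proof -
  have "(\<lambda>u v. u \<in> X \<and> v \<in> X \<and> R u v)\<^sup>*\<^sup>* a b" using assms unfolding conn_def by blast
  then show ?thesis
  proof (induction rule: rtranclp_induct)
    case base
    show ?case using ind_path_singleton[of a] assms(2) by (intro exI[of _ "[a]"]) auto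
  next
    case (step y z)
    then obtain xs where xs: "ind_path R xs" "hd xs = a" "last xs = y" "set xs \<subseteq> X" by blast
    have ne: "xs \<noteq> []" using xs(1) unfolding ind_path_def by blast
    show ?case
    proof (cases "z \<in> set xs")
      case True
      then obtain i where i: "i < length xs" "xs ! i = z" by (auto simp: in_set_conv_nth)
      have "ind_path R (take (Suc i) xs)" using ind_path_segment[OF xs(1), of 0 "Suc i"] ne by simp
      moreover have "last (take (Suc i) xs) = z" using i by (simp add: take_Suc_conv_app_nth)
      moreover have "set (take (Suc i) xs) \<subseteq> X" using xs(4) by (auto dest: in_set_takeD)
      ultimately show ?thesis using xs(2) by (intro exI[of _ "take (Suc i) xs"]) (auto simp: hd_take)
    next
      case False
      define i where "i = (LEAST i. i < length xs \<and> R (xs ! i) z)"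
      have "length xs - 1 < length xs \<and> R (xs ! (length xs - 1)) z"
        using step(2) xs(3) ne by (auto simp: last_conv_nth)
      then have i: "i < length xs" "R (xs ! i) z" and
        least: "\<And>k. k < length xs \<Longrightarrow> R (xs ! k) z \<Longrightarrow> i \<le> k"
        using LeastI[of "\<lambda>i. i < length xs \<and> R (xs ! i) z"] Least_le[of "\<lambda>i. i < length xs \<and> R (xs ! i) z"]
        unfolding i_def by blast+
      have l: "last (take (Suc i) xs) = xs ! i" using i by (simp add: take_Suc_conv_app_nth)
      have "ind_path R (take (Suc i) xs @ [z])"
      proof (rule ind_path_append)
        show "ind_path R (take (Suc i) xs)" using ind_path_segment[OF xs(1), of 0 "Suc i"] ne by simp
        show "ind_path R [z]" by (rule ind_path_singleton)
        show "set (take (Suc i) xs) \<inter> set [z] = {}" using False by (auto dest: in_set_takeD)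
        fix x y assume x: "x \<in> set (take (Suc i) xs)" and y: "y \<in> set [z]"
        obtain k where k: "k < Suc i" "k < length xs" "x = xs ! k"
          using x by (auto simp: in_set_conv_nth)
        show "R x y \<longleftrightarrow> x = last (take (Suc i) xs) \<and> y = hd [z]"
          unfolding l using least[of k] k i y by (auto simp: less_Suc_eq)
      qed
      moreover have "set (take (Suc i) xs @ [z]) \<subseteq> X"
        using xs(4) step(2) by (auto dest: in_set_takeD)
      moreover have "hd (take (Suc i) xs @ [z]) = a" using xs(2) ne by (simp add: hd_append)
      ultimately show ?thesis by (intro exI[of _ "take (Suc i) xs @ [z]"]) auto
    qed
  qed
qed

lemma conn_induced_path':
  assumes "conn R X" "a \<in> X" "b \<in> X" "a \<noteq> b"
  shows "\<exists>ys. ind_path R (a # ys @ [b]) \<and> set ys \<subseteq> X - {a, b}"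
proof -
  obtain xs where xs: "ind_path R xs" "hd xs = a" "last xs = b" "set xs \<subseteq> X"
    using conn_induced_path[OF assms(1-3)] by blast
  then obtain ys where ys: "xs = a # ys @ [b]"
    using list_two_ends[of xs] assms(4) unfolding ind_path_def by metis
  have "set ys \<subseteq> X - {a, b}" using xs ys by (auto dest: ind_path_distinct)
  moreover have "ind_path R (a # ys @ [b])" using xs(1) ys by simp
  ultimately show ?thesis by blast
qed

section \<open>Connected sets\<close>

text \<open>Together with \<open>not_conn_split\<close> this describes connectivity by cuts, which
  most later arguments use instead of walks.\<close>

lemma conn_cross_edge:
  assumes "conn R X" "S \<union> T = X" "S \<noteq> {}" "T \<noteq> {}" "S \<inter> T = {}"
  shows "\<exists>s\<in>S. \<exists>t\<in>T. R s t"
proof (rule ccontr)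
  assume no: "\<not> ?thesis"
  obtain s t where st: "s \<in> S" "t \<in> T" using assms by blast
  have "(\<lambda>u v. u \<in> X \<and> v \<in> X \<and> R u v)\<^sup>*\<^sup>* s t" using assms st unfolding conn_def by blast
  then have "t \<in> S"
    by (induction rule: rtranclp_induct) (use st no assms(2) in blast)+
  then show False using st assms(5) by blast
qed

lemma not_conn_split:
  assumes "\<not> conn R X"
  obtains S T where "S \<union> T = X" "S \<inter> T = {}" "S \<noteq> {}" "T \<noteq> {}" "\<forall>s\<in>S. \<forall>t\<in>T. \<not> R s t"
proof -
  obtain x y where xy: "x \<in> X" "y \<in> X" "\<not> (\<lambda>u v. u \<in> X \<and> v \<in> X \<and> R u v)\<^sup>*\<^sup>* x y"
    using assms unfolding conn_def by blast
  define S where "S = {z \<in> X. (\<lambda>u v. u \<in> X \<and> v \<in> X \<and> R u v)\<^sup>*\<^sup>* x z}"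
  have "\<forall>s\<in>S. \<forall>t\<in>X - S. \<not> R s t"
    unfolding S_def by (auto dest: rtranclp.rtrancl_into_rtrancl)
  then show ?thesis using xy by (intro that[of S "X - S"]) (auto simp: S_def)
qed

lemma connI:
  assumes "\<And>S T. S \<union> T = X \<Longrightarrow> S \<inter> T = {} \<Longrightarrow> S \<noteq> {} \<Longrightarrow> T \<noteq> {} \<Longrightarrow> \<exists>s\<in>S. \<exists>t\<in>T. R s t"
  shows "conn R X"
  using assms not_conn_split by metis

lemma conn_singleton: "conn R {a}"
  unfolding conn_def by auto

lemma conn_Un:
  assumes "conn R P" "conn R Q" "P \<inter> Q \<noteq> {}"
  shows "conn R (P \<union> Q)"
proof (rule connI)
  fix S T assume ST: "S \<union> T = P \<union> Q" "S \<inter> T = {}" "S \<noteq> {}" "T \<noteq> {}"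
  have *: "Z \<subseteq> S \<or> Z \<subseteq> T \<or> (\<exists>s\<in>S. \<exists>t\<in>T. R s t)" if "conn R Z" "Z \<subseteq> P \<union> Q" for Z
    using conn_cross_edge[OF that(1), of "Z \<inter> S" "Z \<inter> T"] that(2) ST by blast
  show "\<exists>s\<in>S. \<exists>t\<in>T. R s t"
    using *[OF assms(1)] *[OF assms(2)] ST assms(3) by blast
qed

lemma conn_insert:
  assumes "conn R X" "x \<in> X" "R v x"
  shows "conn R (insert v X)"
proof -
  have "conn R {v, x}"
  proof (rule connI)
    fix S T assume ST: "S \<union> T = {v, x}" "S \<inter> T = {}" "S \<noteq> {}" "T \<noteq> {}"
    then obtain s t where st: "s \<in> S" "t \<in> T" by blast
    have "s \<noteq> t" "s \<in> {v, x}" "t \<in> {v, x}" unfolding ST(1)[symmetric] using ST(2) st by auto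
    then have "R s t" using assms(3) sym[OF assms(3)] by auto
    then show "\<exists>s\<in>S. \<exists>t\<in>T. R s t" using st by blast
  qed
  then have "conn R ({v, x} \<union> X)" by (rule conn_Un[OF _ assms(1)]) (use assms(2) in auto)
  moreover have "{v, x} \<union> X = insert v X" using assms(2) by blast
  ultimately show ?thesis by simp
qed

lemma conn_set_ind_path:
  assumes "ind_path R xs"
  shows "conn R (set xs)"
  using assms(1)
proof (induction xs rule: rev_induct)
  case Nil
  then show ?case unfolding ind_path_def by simp
next
  case (snoc x xs)
  show ?case
  proof (cases "xs = []")
    case True
    then show ?thesis using conn_singleton by simp
  next
    case False
    have "R x (last xs)"
      using ind_path_iff_nth[OF snoc.prems, of "length xs" "length xs - 1"] False
      by (simp add: nth_append last_conv_nth)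
    then have "conn R (insert x (set xs))"
      using conn_insert[OF snoc.IH[OF ind_path_prefix[OF snoc.prems False]], of "last xs" x] False
      by simp
    then show ?thesis by simp
  qed
qed

text \<open>An edge leaving \<open>C\<close> would allow a larger connected set, and a larger
  connected set would contain an edge leaving \<open>C\<close>.\<close>

lemma component_of_iff:
  shows "component_of R A C \<longleftrightarrow>
    C \<noteq> {} \<and> C \<subseteq> A \<and> conn R C \<and> (\<forall>x\<in>C. \<forall>y\<in>A - C. \<not> R x y)" (is "?L \<longleftrightarrow> ?P")
proof
  assume L: ?L
  have "\<not> R x y" if "x \<in> C" "y \<in> A - C" for x y
  proof
    assume "R x y"
    then have "R y x" by (rule sym)
    moreover have "conn R C" using L unfolding component_of_def by blast
    ultimately have "conn R (insert y C)" using conn_insert that(1) by blast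
    then have "insert y C = C" using L that unfolding component_of_def by blast
    then show False using that by blast
  qed
  then show ?P using L unfolding component_of_def by blast
next
  assume P: ?P
  have "D = C" if "C \<subseteq> D" "D \<subseteq> A" "conn R D" for D
    using conn_cross_edge[OF that(3), of C "D - C"] that P by blast
  then show ?L using P unfolding component_of_def by blast
qed

lemma component_of_superset:
  assumes "finite A" "C \<subseteq> A" "C \<noteq> {}" "conn R C"
  obtains D where "component_of R A D" "C \<subseteq> D"
proof -
  let ?F = "{D. C \<subseteq> D \<and> D \<subseteq> A \<and> conn R D}"
  have "finite ?F" using assms(1) by (auto intro: finite_subset[of _ "Pow A"])
  moreover have "?F \<noteq> {}" using assms by auto
  ultimately obtain D where D: "D \<in> ?F" "\<forall>D'\<in>?F. D \<subseteq> D' \<longrightarrow> D = D'"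
    by (rule finite_has_maximal[THEN bexE])
  have "component_of R A D"
    unfolding component_of_def
  proof (intro conjI allI impI)
    fix D' assume "D \<subseteq> D' \<and> D' \<subseteq> A \<and> conn R D'"
    then show "D' = D" using D by auto
  qed (use D(1) assms(3) in auto)
  then show ?thesis using that D(1) by simp
qed

text \<open>A maximal connected proper subset \<open>M\<close> of \<open>S\<close> containing
  \<open>c\<close> has a neighbour \<open>y\<close> in \<open>S - M\<close>. By maximality
  \<open>insert y M\<close> is all of \<open>S\<close>, so \<open>y\<close> is the vertex
  sought.\<close>

lemma ex_noncut_vertex:
  assumes "finite S" "conn R S" "c \<in> S" "S \<noteq> {c}"
  obtains x where "x \<in> S" "x \<noteq> c" "conn R (S - {x})"
proof -
  let ?F = "{M. M \<subset> S \<and> c \<in> M \<and> conn R M}"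
  have "finite ?F" using assms(1) by (auto intro: finite_subset[of _ "Pow S"])
  moreover have "?F \<noteq> {}" using assms(3,4) conn_singleton[of c] by auto
  ultimately obtain M where M: "M \<in> ?F" "\<forall>M'\<in>?F. M \<subseteq> M' \<longrightarrow> M = M'"
    by (rule finite_has_maximal[THEN bexE])
  have MS: "M \<subset> S" "c \<in> M" "conn R M" using M(1) by simp_all
  then obtain x y where xy: "x \<in> M" "y \<in> S - M" "R x y"
    using conn_cross_edge[OF assms(2), of M "S - M"] by auto
  have c: "conn R (insert y M)" by (rule conn_insert[OF MS(3) xy(1) sym[OF xy(3)]])
  have "insert y M = S"
  proof (rule ccontr)
    assume "insert y M \<noteq> S"
    then have "insert y M \<in> ?F" using c MS xy(2) by auto
    then show False using bspec[OF M(2), of "insert y M"] xy(2) by auto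
  qed
  then have "S - {y} = M" using xy by blast
  then show ?thesis using that[of y] xy MS by auto
qed

text \<open>Applied to the complement, this is the case distinction for an anticonnected set, where
  \<open>complete\<close> is the case of a stable set. Without a cut vertex, the first three
  vertices of an induced path between nonadjacent vertices form the cherry; a cut vertex leaves two
  sides, and each contains a vertex that can be removed.\<close>

lemma conn_trichotomy:
  assumes fin: "finite X" and X: "conn R X"
  obtains (complete) "\<And>x y. x \<in> X \<Longrightarrow> y \<in> X \<Longrightarrow> x \<noteq> y \<Longrightarrow> R x y"
  | (cherry) a b c where "a \<in> X" "b \<in> X" "c \<in> X" "a \<noteq> b" "R a c" "R c b" "\<not> R a b"
      "conn R (X - {a})" "conn R (X - {b})"
  | (leaves) a b where "a \<in> X" "b \<in> X" "a \<noteq> b" "\<not> R a b"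
      "conn R (X - {a})" "conn R (X - {b})" "conn R (X - {a, b})" "X - {a, b} \<noteq> {}"
proof (cases "\<forall>c\<in>X. conn R (X - {c})")
  case True
  show ?thesis
  proof (cases "\<exists>a\<in>X. \<exists>b\<in>X. a \<noteq> b \<and> \<not> R a b")
    case F: True
    then obtain a b where ab: "a \<in> X" "b \<in> X" "a \<noteq> b" "\<not> R a b" by blast
    then obtain ys where ys: "ind_path R (a # ys @ [b])" "set ys \<subseteq> X - {a, b}"
      using conn_induced_path'[OF X, of a b] by blast
    have "ys \<noteq> []" using ys(1) ab(4) ind_path_pair[of R a b] by auto
    then obtain y zs where y: "ys = y # zs" by (cases ys) auto
    obtain d ws where d: "zs @ [b] = d # ws" by (cases zs) auto
    have p: "ind_path R (a # y # d # ws)" using ys(1) y d by simp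
    have "d \<in> set (zs @ [b])" unfolding d by simp
    then have "d \<in> X" "y \<in> X" using ys(2) ab(2) y by auto
    moreover have "R a y" "R y d" "\<not> R a d"
      using ind_path_iff_nth[OF p, of 0 1] ind_path_iff_nth[OF p, of 1 2] ind_path_iff_nth[OF p, of 0 2]
      by auto
    moreover have "a \<noteq> d" using ind_path_distinct[OF p] by simp
    ultimately show ?thesis using cherry[of a d y] ab(1) True by blast
  next
    case False
    then show ?thesis using complete by blast
  qed
next
  case False
  then obtain c where c: "c \<in> X" "\<not> conn R (X - {c})" by blast
  obtain S T where ST: "S \<union> T = X - {c}" "S \<inter> T = {}" "S \<noteq> {}" "T \<noteq> {}" "\<forall>s\<in>S. \<forall>t\<in>T. \<not> R s t"
    using not_conn_split[OF c(2)] by blast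
  \<comment> \<open>In a split of \<open>insert c P\<close>, the part without \<open>c\<close> has
    an edge to the rest of \<open>X\<close>, and this edge cannot lead to the other side
    \<open>Q\<close>.\<close>
  have side: "conn R (insert c P)"
    if PQ: "P \<union> Q = X - {c}" "P \<inter> Q = {}" "\<forall>s\<in>P. \<forall>t\<in>Q. \<not> R s t" for P Q
  proof -
    have *: "\<exists>s\<in>U. \<exists>t\<in>W. R s t"
      if UW: "U \<union> W = insert c P" "U \<inter> W = {}" "W \<noteq> {}" "c \<in> U" for U W
    proof -
      have WP: "W \<subseteq> P" using UW by blast
      have "(U \<union> Q) \<union> W = insert c P \<union> Q" using UW(1) by blast
      also have "\<dots> = X" using PQ(1) c(1) by blast
      finally obtain s t where st: "s \<in> U \<union> Q" "t \<in> W" "R s t"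
        using conn_cross_edge[OF X, of "U \<union> Q" W] UW(2-4) WP PQ(2) by blast
      then have "s \<notin> Q" using WP PQ(3) sym[OF st(3)] by blast
      then show ?thesis using st by blast
    qed
    show ?thesis
    proof (rule connI)
      fix U W assume UW: "U \<union> W = insert c P" "U \<inter> W = {}" "U \<noteq> {}" "W \<noteq> {}"
      have "c \<in> U \<or> c \<in> W" using UW(1) by blast
      then show "\<exists>s\<in>U. \<exists>t\<in>W. R s t"
      proof
        assume "c \<in> U" then show ?thesis using *[OF UW(1,2,4)] by blast
      next
        assume "c \<in> W"
        moreover have "W \<union> U = insert c P" "W \<inter> U = {}" using UW(1,2) by blast+
        ultimately show ?thesis using *[of W U] UW(3) sym by blast
      qed
    qed
  qed
  have S: "conn R (insert c S)" by (rule side[OF ST(1,2,5)])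
  have T: "conn R (insert c T)" by (rule side[of T S]) (use ST sym in blast)+
  have "S \<subseteq> X" "T \<subseteq> X" using ST(1) by blast+
  then have fins: "finite (insert c S)" "finite (insert c T)"
    using fin finite_subset by auto
  have "c \<notin> S" "c \<notin> T" using ST(1) by blast+
  obtain a where a: "a \<in> insert c S" "a \<noteq> c" "conn R (insert c S - {a})"
    using ex_noncut_vertex[OF fins(1) S, of c] ST(3) \<open>c \<notin> S\<close> by blast
  obtain b where b: "b \<in> insert c T" "b \<noteq> c" "conn R (insert c T - {b})"
    using ex_noncut_vertex[OF fins(2) T, of c] ST(4) \<open>c \<notin> T\<close> by blast
  have ab: "a \<in> S" "b \<in> T" using a(1,2) b(1,2) by auto
  then have nab: "\<not> R a b" "a \<noteq> b" "a \<in> X" "b \<in> X" "a \<notin> T" "b \<notin> S"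
    using ST(2,5) \<open>S \<subseteq> X\<close> \<open>T \<subseteq> X\<close> by auto
  have "conn R ((insert c S - {a}) \<union> insert c T)" by (rule conn_Un[OF a(3) T]) (use a in blast)
  moreover have "(insert c S - {a}) \<union> insert c T = insert c (S \<union> T) - {a}"
    using nab a(2) by auto
  moreover have "conn R (insert c S \<union> (insert c T - {b}))" by (rule conn_Un[OF S b(3)]) (use b in blast)
  moreover have "insert c S \<union> (insert c T - {b}) = insert c (S \<union> T) - {b}"
    using nab b(2) by auto
  moreover have "conn R ((insert c S - {a}) \<union> (insert c T - {b}))"
    by (rule conn_Un[OF a(3) b(3)]) (use a b in blast)
  moreover have "(insert c S - {a}) \<union> (insert c T - {b}) = insert c (S \<union> T) - {a, b}"
    using nab a(2) b(2) by auto
  moreover have "insert c (S \<union> T) = X" using ST(1) c(1) by blast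
  ultimately show ?thesis using leaves[of a b] nab(1-4) c(1) a(2) b(2) by auto
qed

end

section \<open>Parity of edge counts\<close>

text \<open>\<open>M\<close> cuts the interval from 0 to \<open>n\<close> into gaps. A gap of length
  1 adds 1 to both counts; every other gap is even and contains no counted edge. The induction
  removes the last gap.\<close>

lemma segment_parity:
  fixes M :: "nat set"
  assumes "0 \<in> M" "n \<in> M"
    and "\<And>i j. i \<in> M \<Longrightarrow> j \<in> M \<Longrightarrow> i < j \<Longrightarrow> j \<le> n \<Longrightarrow> (\<And>k. i < k \<Longrightarrow> k < j \<Longrightarrow> k \<notin> M) \<Longrightarrow>
      odd (j - i) \<Longrightarrow> j = Suc i"
  shows "odd (card {i. i < n \<and> i \<in> M \<and> Suc i \<in> M}) \<longleftrightarrow> odd n"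
  using assms(2,3)
proof (induction n rule: less_induct)
  case (less n)
  show ?case
  proof (cases "n = 0")
    case False
    define m where "m = Max {k \<in> M. k < n}"
    have "m \<in> {k \<in> M. k < n}"
      unfolding m_def by (rule Max_in) (use False assms(1) in auto)
    moreover have max: "k \<le> m" if "k \<in> M" "k < n" for k
      unfolding m_def by (rule Max_ge) (use that in auto)
    ultimately have m: "m \<in> M" "m < n" by auto
    have gap: "k \<notin> M" if "m < k" "k < n" for k using max[of k] that by auto
    have IH: "odd (card {i. i < m \<and> i \<in> M \<and> Suc i \<in> M}) \<longleftrightarrow> odd m"
      using less.IH[OF m(2,1)] less.prems(2) m(2) by force
    have seg: "odd (n - m) \<Longrightarrow> n = Suc m"
      using less.prems(2)[OF m(1) less.prems(1) m(2)] gap by blast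
    show ?thesis
    proof (cases "n = Suc m")
      case True
      have "{i. i < n \<and> i \<in> M \<and> Suc i \<in> M} = insert m {i. i < m \<and> i \<in> M \<and> Suc i \<in> M}"
        using True m less.prems(1) by (auto simp: less_Suc_eq)
      then show ?thesis using IH True by simp
    next
      case F: False
      have "i < m" if "i < n" "i \<in> M" "Suc i \<in> M" for i
      proof (rule ccontr)
        assume "\<not> i < m"
        then have "i = m" using max[OF that(2,1)] by simp
        then show False using gap[of "Suc i"] that F m(2) by auto
      qed
      then have "{i. i < n \<and> i \<in> M \<and> Suc i \<in> M} = {i. i < m \<and> i \<in> M \<and> Suc i \<in> M}"
        using m(2) by auto
      moreover have "even n \<longleftrightarrow> even m" using seg F m(2) by auto
      ultimately show ?thesis using IH by simp
    qed
  qed auto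
qed

text \<open>Double counting: an index \<open>i\<close> is counted once for each nonempty subset of
  \<open>C i\<close>, and their number \<open>2 ^ card (C i) - 1\<close> is odd unless
  \<open>C i\<close> is empty.\<close>

lemma odd_sum_card_subsets:
  assumes "finite I" "finite T" "\<And>i. i \<in> I \<Longrightarrow> C i \<subseteq> T"
  shows "odd (\<Sum>S \<in> Pow T - {{}}. card {i \<in> I. S \<subseteq> C i}) \<longleftrightarrow> odd (card {i \<in> I. C i \<noteq> {}})"
proof -
  have "(\<Sum>S \<in> Pow T - {{}}. card {i \<in> I. S \<subseteq> C i})
      = (\<Sum>S \<in> Pow T - {{}}. \<Sum>i\<in>I. if S \<subseteq> C i then 1 else 0)"
    using assms(1) by (intro sum.cong refl) (simp add: sum.If_cases Int_def)
  also have "\<dots> = (\<Sum>i\<in>I. \<Sum>S \<in> Pow T - {{}}. if S \<subseteq> C i then 1 else 0)"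
    by (rule sum.swap)
  also have "\<dots> = (\<Sum>i\<in>I. 2 ^ card (C i) - 1)"
  proof (intro sum.cong refl)
    fix i assume "i \<in> I"
    then have C: "C i \<subseteq> T" "finite (C i)" using assms(2,3) finite_subset by blast+
    have "(\<Sum>S \<in> Pow T - {{}}. if S \<subseteq> C i then 1 else 0) = card ((Pow T - {{}}) \<inter> {S. S \<subseteq> C i})"
      using assms(2) by (simp add: sum.If_cases)
    also have "(Pow T - {{}}) \<inter> {S. S \<subseteq> C i} = Pow (C i) - {{}}" using C(1) by blast
    also have "card (Pow (C i) - {{}}) = 2 ^ card (C i) - 1" using C(2) by (simp add: card_Pow)
    finally show "(\<Sum>S \<in> Pow T - {{}}. if S \<subseteq> C i then 1 else 0) = (2 ^ card (C i) - 1 :: nat)" .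
  qed
  also have "odd \<dots> \<longleftrightarrow> odd (card {i \<in> I. odd (2 ^ card (C i) - 1 :: nat)})"
    using assms(1) by (simp add: even_sum_iff)
  also have "{i \<in> I. odd (2 ^ card (C i) - 1 :: nat)} = {i \<in> I. C i \<noteq> {}}"
    using finite_subset[OF assms(3) assms(2)] by (auto simp: card_gt_0_iff)
  finally show ?thesis .
qed

section \<open>Complete edges of odd paths\<close>

lemma ind_path_between:
  assumes p: "ind_path R xs" and ij: "i < j" "j < length xs"
  obtains ys where "ind_path R (xs ! i # ys @ [xs ! j])" "length ys = j - i - 1"
    "set ys = (!) xs ` {i<..<j}"
proof -
  let ?ys = "map ((!) xs) [Suc i..<j]"
  have "take (Suc (j - i)) (drop i xs) = map ((!) xs) [i..<Suc j]"
    using ij by (intro nth_equalityI) (auto simp: nth_append less_Suc_eq)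
  also have "[i..<Suc j] = i # [Suc i..<j] @ [j]" using ij(1) by (simp add: upt_conv_Cons)
  finally have "take (Suc (j - i)) (drop i xs) = xs ! i # ?ys @ [xs ! j]" by simp
  moreover have "ind_path R (take (Suc (j - i)) (drop i xs))"
    using ij by (intro ind_path_segment[OF p]) auto
  ultimately have "ind_path R (xs ! i # ?ys @ [xs ! j])" by simp
  then show ?thesis using that[of ?ys] by (auto simp: atLeastSucLessThan_greaterThanLessThan)
qed

lemma (in adjacency) ind_path_through:
  assumes "conn R X" "u \<notin> X" "v \<notin> X" "u \<noteq> v" "x \<in> X" "R u x" "y \<in> X" "R v y"
  obtains ys where "ind_path R (u # ys @ [v])" "set ys \<subseteq> X"
proof -
  have "conn R (insert u X)" by (rule conn_insert[OF assms(1,5,6)])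
  then have "conn R (insert v (insert u X))" by (rule conn_insert) (use assms in auto)
  then obtain ys where "ind_path R (u # ys @ [v])" "set ys \<subseteq> insert v (insert u X) - {u, v}"
    using conn_induced_path'[of "insert v (insert u X)" u v] assms(4) by auto
  then show ?thesis by (intro that[of ys]) auto
qed

text \<open>The two halves of balance, for one pair of sets; \<open>ys\<close> is the interior of the path, which
  has odd length (number of edges) iff \<open>ys\<close> has even length.\<close>

definition even_paths :: "('a \<Rightarrow> 'a \<Rightarrow> bool) \<Rightarrow> 'a set \<Rightarrow> 'a set \<Rightarrow> bool" where
  "even_paths R A B \<longleftrightarrow> (\<forall>u\<in>B. \<forall>v\<in>B. \<forall>ys.
     ind_path R (u # ys @ [v]) \<and> \<not> R u v \<and> set ys \<subseteq> A \<longrightarrow> odd (length ys))"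

definition balanced_pair :: "('a \<Rightarrow> 'a \<Rightarrow> bool) \<Rightarrow> 'a set \<Rightarrow> 'a set \<Rightarrow> bool" where
  "balanced_pair R A B \<longleftrightarrow> even_paths R A B \<and> even_paths (coadj R) B A"

lemma even_pathsD:
  "even_paths R A B \<Longrightarrow> ind_path R (u # ys @ [v]) \<Longrightarrow> u \<in> B \<Longrightarrow> v \<in> B \<Longrightarrow> \<not> R u v \<Longrightarrow> set ys \<subseteq> A \<Longrightarrow>
    odd (length ys)"
  unfolding even_paths_def by blast

lemma even_paths_mono: "even_paths R A B \<Longrightarrow> A' \<subseteq> A \<Longrightarrow> B' \<subseteq> B \<Longrightarrow> even_paths R A' B'"
  unfolding even_paths_def by (meson subset_iff)

lemma balanced_pair_mono: "balanced_pair R A B \<Longrightarrow> A' \<subseteq> A \<Longrightarrow> B' \<subseteq> B \<Longrightarrow> balanced_pair R A' B'"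
  unfolding balanced_pair_def using even_paths_mono by blast

lemma adjacency_coadj: "adjacency R \<Longrightarrow> adjacency (coadj R)"
  unfolding adjacency_def coadj_def by blast

text \<open>No vertex set is needed: a vertex outside \<open>V\<close> is isolated in \<open>E\<close>, hence lies on no hole of \<open>E\<close>
  or of its complement.\<close>

locale berge_adjacency = adjacency +
  assumes hole: "ind_hole R xs \<Longrightarrow> even (length xs)"
    and antihole: "ind_hole (coadj R) xs \<Longrightarrow> even (length xs)"
begin

lemma coadj_coadj_eq: "coadj (coadj R) = R"
  using irrefl by (rule coadj_coadj)

lemma berge_adjacency_coadj: "berge_adjacency (coadj R)"
  using adjacency_coadj[OF adjacency_axioms] hole antihole coadj_coadj_eq
  by (simp add: berge_adjacency_def berge_adjacency_axioms_def)

lemma balanced_pair_coadj: "balanced_pair (coadj R) B A \<longleftrightarrow> balanced_pair R A B"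
  unfolding balanced_pair_def coadj_coadj_eq by blast

lemma even_two_paths:
  assumes "ind_path R (u # ys @ [v])" "ind_path R (u # zs @ [v])" "\<not> R u v"
    and "\<And>y z. y \<in> set ys \<Longrightarrow> z \<in> set zs \<Longrightarrow> y \<noteq> z \<and> \<not> R y z"
  shows "even (length ys + length zs)"
  using hole[OF ind_hole_two_paths[OF assms]] by simp

text \<open>The path \<open>u\<close>, \<open>w\<close>, \<open>v\<close> closes the given path into
  a hole with \<open>length ys + 3\<close> vertices. In the complement, the same argument serves for
  a common nonneighbour.\<close>

lemma odd_path_common_neighbour:
  assumes "ind_path R (u # ys @ [v])" "\<not> R u v" "R u w" "R v w"
    and "\<And>y. y \<in> set ys \<Longrightarrow> y \<noteq> w \<and> \<not> R y w"
  shows "odd (length ys)"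
proof -
  have "u \<noteq> v" using assms(1) by (auto dest: ind_path_distinct)
  then have "ind_path R (u # [w] @ [v])" using assms sym by (simp add: ind_path_three)
  then show ?thesis using even_two_paths[OF assms(1) _ assms(2), of "[w]"] assms(5) by auto
qed

end

section \<open>Minimal counterexample to the parity of complete edges\<close>

text \<open>This situation is shown to be contradictory. \<open>xs\<close> is a segment with an odd
  number, at least 3, of edges between consecutive \<open>X\<close>-complete vertices of some path;
  \<open>IH\<close> is the parity statement for the smaller anticonnected sets, on this one
  segment.\<close>

locale rr_counterexample = berge_adjacency +
  fixes A X :: "'a set" and xs :: "'a list"
  assumes finX: "finite X" and X0: "X \<noteq> {}" and connX: "conn (coadj R) X"
    and disj: "A \<inter> X = {}" and bal: "balanced_pair R A X"
    and path: "ind_path R xs" and even_len: "even (length xs)" and len: "length xs \<ge> 4"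
    and interior: "\<And>k. 0 < k \<Longrightarrow> Suc k < length xs \<Longrightarrow> xs ! k \<in> A"
    and first: "\<And>x. x \<in> X \<Longrightarrow> R (xs ! 0) x"
    and last: "\<And>x. x \<in> X \<Longrightarrow> R (xs ! (length xs - 1)) x"
    and none: "\<And>k. 0 < k \<Longrightarrow> Suc k < length xs \<Longrightarrow> \<exists>x\<in>X. \<not> R (xs ! k) x"
    and IH: "\<And>Y. Y \<subset> X \<Longrightarrow> Y \<noteq> {} \<Longrightarrow> conn (coadj R) Y \<Longrightarrow>
      odd (card {i. Suc i < length xs \<and> (\<forall>y\<in>Y. R (xs ! i) y \<and> R (xs ! Suc i) y)})"
begin

interpretation co: berge_adjacency "coadj R"
  by (rule berge_adjacency_coadj)

lemma even_R: "even_paths R A X" and even_coadj: "even_paths (coadj R) X A"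
  using bal unfolding balanced_pair_def by blast+

lemma nth_adj: "i < length xs \<Longrightarrow> j < length xs \<Longrightarrow> R (xs ! i) (xs ! j) \<longleftrightarrow> i = Suc j \<or> j = Suc i"
  by (rule ind_path_iff_nth[OF path])

lemma nth_eq: "i < length xs \<Longrightarrow> j < length xs \<Longrightarrow> xs ! i = xs ! j \<longleftrightarrow> i = j"
  using ind_path_distinct[OF path] by (simp add: nth_eq_iff_index_eq)

lemma nth_notin: assumes "k < length xs" shows "xs ! k \<notin> X"
proof
  assume x: "xs ! k \<in> X"
  then have "k = 0 \<or> Suc k = length xs" using interior[of k] disj assms by (cases "k = 0") (auto simp: not_less_eq less_Suc_eq)
  then show False using first[OF x] last[OF x] irrefl by (auto simp: diff_Suc split: nat.splits)
qed

text \<open>A path \<open>?p\<close>, \<open>?q\<close>, \<open>?r\<close>, \<open>?s\<close> with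
  three edges is the path \<open>?q\<close>, \<open>?s\<close>, \<open>?p\<close>, \<open>?r\<close>
  in the complement. As \<open>?p\<close> and \<open>?s\<close> are complete to \<open>X\<close>, it
  closes an antipath from \<open>?q\<close> to \<open>?r\<close> through \<open>X\<close>, whose
  interior is odd by balance, into an odd antihole.\<close>

lemma len_ge_6: "length xs \<ge> 6"
proof (rule ccontr)
  assume "\<not> ?thesis"
  then have l: "length xs = 4" using len even_len by presburger
  let ?p = "xs ! 0" and ?q = "xs ! 1" and ?r = "xs ! 2" and ?s = "xs ! 3"
  have qr: "?q \<in> A" "?r \<in> A" using interior[of 1] interior[of 2] l by auto
  obtain x y where xy: "x \<in> X" "\<not> R ?q x" "y \<in> X" "\<not> R ?r y"
    using none[of 1] none[of 2] l by auto
  have adj: "R ?p ?q" "R ?q ?r" "R ?r ?s" "\<not> R ?p ?r" "\<not> R ?q ?s" "\<not> R ?p ?s" "distinct [?p, ?q, ?r, ?s]"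
    using l by (auto simp: nth_adj nth_eq)
  obtain ys where ys: "ind_path (coadj R) (?q # ys @ [?r])" "set ys \<subseteq> X"
  proof (rule co.ind_path_through[OF connX, of ?q ?r x y])
    show "coadj R ?q x" "coadj R ?r y" using xy nth_notin[of 1] nth_notin[of 2] l by (auto simp: coadj_def)
    show "?q \<notin> X" "?r \<notin> X" "?q \<noteq> ?r" using nth_notin[of 1] nth_notin[of 2] l adj by auto
  qed (use xy in auto)
  have "odd (length ys)"
    using even_pathsD[OF even_coadj ys(1) qr _ ys(2)] adj by (simp add: coadj_def)
  moreover have "even (length ys + length [?s, ?p])"
  proof (rule co.even_two_paths[OF ys(1)])
    have "ind_path (coadj R) [?q, ?s, ?p, ?r]"
      using adj sym by (intro co.ind_path_four) (auto simp: coadj_def)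
    then show "ind_path (coadj R) (?q # [?s, ?p] @ [?r])" by simp
    show "\<not> coadj R ?q ?r" using adj by (simp add: coadj_def)
    fix y z assume "y \<in> set ys" "z \<in> set [?s, ?p]"
    then have "y \<in> X" "R z y" "z \<notin> X" using ys(2) first last l nth_notin[of 0] nth_notin[of 3] by auto
    then show "y \<noteq> z \<and> \<not> coadj R y z" using sym by (auto simp: coadj_def)
  qed
  ultimately show False by simp
qed

text \<open>Modulo 2, the number of edges whose ends have a common neighbour in \<open>X\<close> is the sum over the
  nonempty \<open>S \<subseteq> X\<close> of the number of \<open>S\<close>-complete edges. All summands are odd except the last,
  \<open>S = X\<close>, which vanishes, so the sum is even; but the intervals between consecutive vertices with a
  neighbour in \<open>X\<close> show that it has the parity of the path.\<close>

lemma stable_False: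
  assumes stable: "\<And>x y. x \<in> X \<Longrightarrow> y \<in> X \<Longrightarrow> x \<noteq> y \<Longrightarrow> coadj R x y"
  shows False
proof -
  define n where "n = length xs - 1"
  have n: "length xs = Suc n" "odd n" using len even_len unfolding n_def by auto
  define M where "M = {k. k \<le> n \<and> (\<exists>x\<in>X. R (xs ! k) x)}"
  define C where "C i = {x \<in> X. R (xs ! i) x \<and> R (xs ! Suc i) x}" for i
  have gap: "j = Suc i \<and> (\<exists>x\<in>X. R (xs ! i) x \<and> R (xs ! j) x)"
    if ij: "i \<in> M" "j \<in> M" "i < j" "j \<le> n" and no: "\<And>k. i < k \<Longrightarrow> k < j \<Longrightarrow> k \<notin> M" and odd: "odd (j - i)" for i j
  proof -
    obtain ys where ys: "ind_path R (xs ! i # ys @ [xs ! j])" "length ys = j - i - 1"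
      "set ys = (!) xs ` {i<..<j}"
      using ind_path_between[OF path, of i j] ij n by auto
    have inner: "y \<notin> X \<and> \<not> R y x" if "y \<in> set ys" "x \<in> X" for x y
      using that no ij n nth_notin unfolding ys(3) M_def by fastforce
    \<comment> \<open>Without a common neighbour, \<open>t\<close>, the segment and
      \<open>t'\<close> form an odd path with ends in the stable set \<open>X\<close>. Neither
      \<open>xs ! i\<close> nor \<open>xs ! j\<close> is then an end of \<open>xs\<close>, as ends
      are complete to \<open>X\<close>; so the interior lies in \<open>A\<close>, against
      balance.\<close>
    have "\<exists>x\<in>X. R (xs ! i) x \<and> R (xs ! j) x"
    proof (rule ccontr)
      assume nc: "\<not> ?thesis"
      obtain t t' where t: "t \<in> X" "R (xs ! i) t" "t' \<in> X" "R (xs ! j) t'" using ij unfolding M_def by blast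
      have "i \<noteq> 0"
      proof
        assume "i = 0"
        then have "R (xs ! i) t'" using first[OF t(3)] by simp
        then show False using nc t by blast
      qed
      moreover have "j \<noteq> n"
      proof
        assume "j = n"
        then have "R (xs ! j) t" using last[OF t(1)] n(1) by simp
        then show False using nc t by blast
      qed
      ultimately have inA: "xs ! i \<in> A" "xs ! j \<in> A" "\<And>k. i < k \<Longrightarrow> k < j \<Longrightarrow> xs ! k \<in> A"
        using interior ij n by auto
      have nt: "\<not> R (xs ! j) t" "\<not> R (xs ! i) t'" "t \<noteq> t'" using nc t by auto
      have ti: "xs ! i \<notin> X" "xs ! j \<notin> X" using nth_notin ij n by auto
      have "ind_path R ([t] @ ((xs ! i # ys @ [xs ! j]) @ [t']))"
      proof (rule ind_path_append[OF ind_path_singleton ind_path_append[OF ys(1) ind_path_singleton]])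
        show "set (xs ! i # ys @ [xs ! j]) \<inter> set [t'] = {}" using t inner ti by auto
        show "set [t] \<inter> set ((xs ! i # ys @ [xs ! j]) @ [t']) = {}" using t inner ti nt by auto
        show "R x y \<longleftrightarrow> x = List.last (xs ! i # ys @ [xs ! j]) \<and> y = hd [t']"
          if "x \<in> set (xs ! i # ys @ [xs ! j])" "y \<in> set [t']" for x y
          using that t inner nt ind_path_distinct[OF ys(1)] by auto
        show "R x y \<longleftrightarrow> x = List.last [t] \<and> y = hd ((xs ! i # ys @ [xs ! j]) @ [t'])"
          if "x \<in> set [t]" "y \<in> set ((xs ! i # ys @ [xs ! j]) @ [t'])" for x y
          using that t inner nt stable[of t t'] sym ind_path_distinct[OF ys(1)] by (auto simp: coadj_def)
      qed
      then have "ind_path R (t # (xs ! i # ys @ [xs ! j]) @ [t'])" by simp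
      moreover have "\<not> R t t'" using stable[of t t'] t nt by (simp add: coadj_def)
      moreover have "set (xs ! i # ys @ [xs ! j]) \<subseteq> A"
        using inA ys(3) by auto
      ultimately have "odd (length (xs ! i # ys @ [xs ! j]))"
        using even_pathsD[OF even_R] t by blast
      then show False using ys(2) odd ij(3) by (auto simp: Suc_diff_Suc)
    qed
    then obtain t where t: "t \<in> X" "R (xs ! i) t" "R (xs ! j) t" by blast
    \<comment> \<open>The common neighbour \<open>t\<close> would close a longer segment into a hole
      of odd length \<open>j - i + 2\<close>.\<close>
    have "j = Suc i"
    proof (rule ccontr)
      assume "j \<noteq> Suc i"
      then have "\<not> R (xs ! i) (xs ! j)" using nth_adj ij n by auto
      then have "odd (length ys)"
        using odd_path_common_neighbour[OF ys(1) _ t(2,3)] inner t(1) by blast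
      then show False using ys(2) odd ij(3) by auto
    qed
    then show ?thesis using t by blast
  qed
  have M: "0 \<in> M" "n \<in> M" using X0 first last n unfolding M_def by auto
  have "odd (card {i. i < n \<and> i \<in> M \<and> Suc i \<in> M})"
    using segment_parity[OF M] gap n(2) by blast
  moreover have "{i. i < n \<and> i \<in> M \<and> Suc i \<in> M} = {i \<in> {..<n}. C i \<noteq> {}}"
    using gap unfolding C_def by (fastforce simp: M_def)
  ultimately have "odd (\<Sum>S \<in> Pow X - {{}}. card {i \<in> {..<n}. S \<subseteq> C i})"
    using odd_sum_card_subsets[of "{..<n}" X C] finX unfolding C_def by auto
  then have "odd (card {S \<in> Pow X - {{}}. odd (card {i \<in> {..<n}. S \<subseteq> C i})})"
    using finX by (simp add: even_sum_iff)
  moreover have "{S \<in> Pow X - {{}}. odd (card {i \<in> {..<n}. S \<subseteq> C i})} = Pow X - {{}, X}"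
  proof -
    have *: "{i \<in> {..<n}. S \<subseteq> C i} = {i. Suc i < length xs \<and> (\<forall>y\<in>S. R (xs ! i) y \<and> R (xs ! Suc i) y)}"
      if "S \<subseteq> X" for S
      using that n unfolding C_def by auto
    have "odd (card {i \<in> {..<n}. S \<subseteq> C i})" if "S \<subset> X" "S \<noteq> {}" for S
    proof -
      have "S \<subseteq> X" using that by blast
      have "conn (coadj R) S"
      proof (rule co.connI)
        fix U W assume "U \<union> W = S" "U \<inter> W = {}" "U \<noteq> {}" "W \<noteq> {}"
        then obtain s t where "s \<in> U" "t \<in> W" "s \<noteq> t" "s \<in> S" "t \<in> S" by auto
        then show "\<exists>s\<in>U. \<exists>t\<in>W. coadj R s t" using stable[of s t] \<open>S \<subseteq> X\<close> by auto
      qed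
      then show ?thesis unfolding *[OF \<open>S \<subseteq> X\<close>] by (rule IH[OF that])
    qed
    moreover have "even (card {i \<in> {..<n}. X \<subseteq> C i})"
    proof -
      \<comment> \<open>Every edge of \<open>xs\<close> has an inner end, which is not
        \<open>X\<close>-complete.\<close>
      have "{i \<in> {..<n}. X \<subseteq> C i} = {}"
      proof (rule ccontr)
        assume "\<not> ?thesis"
        then obtain i where i: "i < n" "X \<subseteq> C i" by auto
        then show False using none[of i] none[of "Suc i"] n len by (cases "i = 0") (auto simp: C_def)
      qed
      then show ?thesis by (simp only: card.empty) simp
    qed
    ultimately show ?thesis by auto
  qed
  moreover have "even (card (Pow X - {{}, X}))"
  proof -
    have "card (Pow X - {{}, X}) = 2 ^ card X - 2"
      using finX X0 by (subst card_Diff_subset) (auto simp: card_Pow)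
    then show ?thesis using finX X0 by (auto simp: card_gt_0_iff)
  qed
  ultimately show False by simp
qed

text \<open>The odd counts in \<open>IH\<close> give one edge complete to \<open>X - {x1}\<close>
  and one complete to \<open>X - {x2}\<close>. They share no inner vertex, since it would be
  \<open>X\<close>-complete, and six vertices leave room for nonadjacent inner vertices, one on each
  edge.\<close>

lemma noncut_pair:
  assumes x: "x1 \<in> X" "x2 \<in> X" "x1 \<noteq> x2"
    and c: "conn (coadj R) (X - {x1})" "conn (coadj R) (X - {x2})"
  obtains a b where "0 < a" "Suc a < length xs" "0 < b" "Suc b < length xs"
    "Suc a < b \<or> Suc b < a"
    "\<forall>x\<in>X - {x1}. R (xs ! a) x" "\<forall>x\<in>X - {x2}. R (xs ! b) x"
proof -
  have nonempty: "S \<noteq> {}" if "odd (card S)" for S :: "nat set" using that by auto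
  obtain i where i: "Suc i < length xs" "\<forall>y\<in>X - {x1}. R (xs ! i) y \<and> R (xs ! Suc i) y"
    using nonempty[OF IH[OF _ _ c(1)]] x by blast
  obtain j where j: "Suc j < length xs" "\<forall>y\<in>X - {x2}. R (xs ! j) y \<and> R (xs ! Suc j) y"
    using nonempty[OF IH[OF _ _ c(2)]] x by blast
  have d: False if "k \<in> {i, Suc i}" "k \<in> {j, Suc j}" "0 < k" "Suc k < length xs" for k
    using none[OF that(3,4)] i j that(1,2) x by blast
  have "\<exists>a\<in>{i, Suc i}. \<exists>b\<in>{j, Suc j}. 0 < a \<and> Suc a < length xs \<and> 0 < b \<and> Suc b < length xs
    \<and> (Suc a < b \<or> Suc b < a)"
    using d[of i] d[of "Suc i"] d[of j] d[of "Suc j"] i(1) j(1) len_ge_6 by simp presburger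
  then show ?thesis using that i j by blast
qed

text \<open>In \<open>X\<close>, the vertex \<open>?u\<close> misses only \<open>x1\<close> and
  \<open>?v\<close> only \<open>x2\<close>. As they are nonadjacent, \<open>x1\<close>,
  \<open>?u\<close>, \<open>?v\<close>, \<open>x2\<close> is an antipath and closes the given one
  into an antihole with \<open>length ys + 4\<close> vertices.\<close>

lemma noncut_adj_even:
  assumes x: "x1 \<in> X" "x2 \<in> X" "R x1 x2"
    and c: "conn (coadj R) (X - {x1})" "conn (coadj R) (X - {x2})"
    and ys: "ind_path (coadj R) (x1 # ys @ [x2])" "set ys \<subseteq> X - {x1, x2}"
  shows "even (length ys)"
proof -
  have "x1 \<noteq> x2" using x irrefl by blast
  obtain a b where ab: "0 < a" "Suc a < length xs" "0 < b" "Suc b < length xs"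
    "Suc a < b \<or> Suc b < a"
    "\<forall>x\<in>X - {x1}. R (xs ! a) x" "\<forall>x\<in>X - {x2}. R (xs ! b) x"
    by (rule noncut_pair[OF x(1,2) \<open>x1 \<noteq> x2\<close> c])
  let ?u = "xs ! a" and ?v = "xs ! b"
  have nX: "?u \<notin> X" "?v \<notin> X" using nth_notin ab by auto
  have nu: "\<not> R ?u x1" "\<not> R ?v x2" using none ab by blast+
  have uv: "\<not> R ?u ?v" "?u \<noteq> ?v" using ab by (auto simp: nth_adj nth_eq)
  have "ind_path (coadj R) [x1, ?u, ?v, x2]"
    using nX nu uv x \<open>x1 \<noteq> x2\<close> ab sym by (intro co.ind_path_four) (auto simp: coadj_def)
  then have "even (length ys + length [?u, ?v])"
  proof (intro co.even_two_paths[OF ys(1)])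
    show "\<not> coadj R x1 x2" using x by (simp add: coadj_def)
    fix y z assume "y \<in> set ys" "z \<in> set [?u, ?v]"
    then have "y \<in> X" "R z y" "z \<notin> X" using ys(2) ab(6,7) nX by auto
    then show "y \<noteq> z \<and> \<not> coadj R y z" using sym by (auto simp: coadj_def)
  qed simp
  then show ?thesis by simp
qed

text \<open>A vertex complete to \<open>X - {x1, x2}\<close> is adjacent to \<open>x1\<close> or \<open>x2\<close>, and no edge mixes the two types.
  So an odd number of edges is the disjoint union of two odd ones.\<close>

lemma leaves_False:
  assumes x: "x1 \<in> X" "x2 \<in> X" "R x1 x2"
    and c: "conn (coadj R) (X - {x1})" "conn (coadj R) (X - {x2})"
    and Y: "conn (coadj R) (X - {x1, x2})" "X - {x1, x2} \<noteq> {}"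
  shows False
proof -
  have ne: "x1 \<noteq> x2" using x irrefl by blast
  obtain ys where ys: "ind_path (coadj R) (x1 # ys @ [x2])" "set ys \<subseteq> X - {x1, x2}"
    using co.conn_induced_path'[OF connX x(1,2) ne] by blast
  have ev: "even (length ys)" by (rule noncut_adj_even[OF x c ys])
  have nc: "\<not> coadj R x1 x2" using x by (simp add: coadj_def)
  define E where "E S = {i. Suc i < length xs \<and> (\<forall>y\<in>S. R (xs ! i) y \<and> R (xs ! Suc i) y)}" for S
  \<comment> \<open>A vertex missing both would close the antipath into an antihole with
    \<open>length ys + 3\<close> vertices, an odd number.\<close>
  have one: "R (xs ! k) x1 \<or> R (xs ! k) x2"
    if k: "k < length xs" "\<forall>y\<in>X - {x1, x2}. R (xs ! k) y" for k
  proof (rule ccontr)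
    assume n: "\<not> ?thesis"
    have "odd (length ys)"
    proof (rule co.odd_path_common_neighbour[OF ys(1) nc])
      show "coadj R x1 (xs ! k)" "coadj R x2 (xs ! k)"
        using n sym nth_notin[OF k(1)] x by (auto simp: coadj_def)
      show "y \<noteq> xs ! k \<and> \<not> coadj R y (xs ! k)" if "y \<in> set ys" for y
        using that ys(2) k(2) sym nth_notin[OF k(1)] by (auto simp: coadj_def)
    qed
    then show False using ev by simp
  qed
  \<comment> \<open>\<open>?u\<close>, \<open>x1\<close>, \<open>ys\<close>, \<open>x2\<close>,
    \<open>?v\<close> would be an antipath between adjacent vertices of \<open>A\<close> whose
    interior has \<open>length ys + 2\<close> vertices, an even number, against balance.\<close>
  have mixed: False
    if k: "0 < k" "Suc k < length xs" "0 < l" "Suc l < length xs" "R (xs ! k) (xs ! l)"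
      "\<forall>y\<in>X - {x1}. R (xs ! k) y" "\<forall>y\<in>X - {x2}. R (xs ! l) y" for k l
  proof -
    let ?u = "xs ! k" and ?v = "xs ! l"
    have nX: "?u \<notin> X" "?v \<notin> X" using nth_notin k by auto
    have nu: "\<not> R ?u x1" "\<not> R ?v x2" using none k by blast+
    have uv: "?u \<noteq> ?v" using k(5) irrefl by metis
    have "ind_path (coadj R) ([?u] @ ((x1 # ys @ [x2]) @ [?v]))"
    proof (rule co.ind_path_append[OF co.ind_path_singleton co.ind_path_append[OF ys(1) co.ind_path_singleton]])
      show "set (x1 # ys @ [x2]) \<inter> set [?v] = {}" using nX x ys(2) by auto
      show "set [?u] \<inter> set ((x1 # ys @ [x2]) @ [?v]) = {}" using nX x ys(2) uv by auto
      show "coadj R y z \<longleftrightarrow> y = List.last (x1 # ys @ [x2]) \<and> z = hd [?v]"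
        if "y \<in> set (x1 # ys @ [x2])" "z \<in> set [?v]" for y z
        using that nX x ys(2) nu k(7) ne sym by (auto simp: coadj_def)
      show "coadj R y z \<longleftrightarrow> y = List.last [?u] \<and> z = hd ((x1 # ys @ [x2]) @ [?v])"
        if "y \<in> set [?u]" "z \<in> set ((x1 # ys @ [x2]) @ [?v])" for y z
        using that nX x ys(2) nu k(5,6) ne by (auto simp: coadj_def)
    qed
    then have "ind_path (coadj R) (?u # (x1 # ys @ [x2]) @ [?v])" by simp
    moreover have "?u \<in> A" "?v \<in> A" using interior k by auto
    moreover have "\<not> coadj R ?u ?v" using k(5) by (simp add: coadj_def)
    moreover have "set (x1 # ys @ [x2]) \<subseteq> X" using x ys(2) by auto
    ultimately have "odd (length (x1 # ys @ [x2]))" using even_pathsD[OF even_coadj] by blast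
    then show False using ev by simp
  qed
  define Q1 where "Q1 k \<longleftrightarrow> (\<forall>y\<in>X - {x1}. R (xs ! k) y)" for k
  define Q2 where "Q2 k \<longleftrightarrow> (\<forall>y\<in>X - {x2}. R (xs ! k) y)" for k
  have E1: "i \<in> E (X - {x1}) \<longleftrightarrow> Suc i < length xs \<and> Q1 i \<and> Q1 (Suc i)" for i
    unfolding E_def Q1_def by auto
  have E2: "i \<in> E (X - {x2}) \<longleftrightarrow> Suc i < length xs \<and> Q2 i \<and> Q2 (Suc i)" for i
    unfolding E_def Q2_def by auto
  have E12: "Suc i < length xs \<and> (Q1 i \<or> Q2 i) \<and> (Q1 (Suc i) \<or> Q2 (Suc i))"
    if "i \<in> E (X - {x1, x2})" for i
    using that one[of i] one[of "Suc i"] unfolding E_def Q1_def Q2_def by auto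
  have both: "k = 0 \<or> Suc k = length xs" if "k < length xs" "Q1 k" "Q2 k" for k
  proof (rule ccontr)
    assume "\<not> ?thesis"
    moreover have "\<forall>x\<in>X. R (xs ! k) x" using that(2,3) ne unfolding Q1_def Q2_def by auto
    ultimately show False using none[of k] that(1) by auto
  qed
  have ends: "Q1 0" "Q2 0" "Q1 (length xs - 1)" "Q2 (length xs - 1)"
    using first last unfolding Q1_def Q2_def by auto
  \<comment> \<open>The ends of the path are of both types, so an edge whose ends have no common
    type consists of inner vertices and falls under \<open>mixed\<close>.\<close>
  have split: "E (X - {x1, x2}) = E (X - {x1}) \<union> E (X - {x2})"
  proof
    show "E (X - {x1}) \<union> E (X - {x2}) \<subseteq> E (X - {x1, x2})" unfolding E_def by auto
    show "E (X - {x1, x2}) \<subseteq> E (X - {x1}) \<union> E (X - {x2})"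
    proof (rule subsetI, rule ccontr)
      fix i assume i: "i \<in> E (X - {x1, x2})" and "i \<notin> E (X - {x1}) \<union> E (X - {x2})"
      then have nE: "\<not> (Q1 i \<and> Q1 (Suc i))" "\<not> (Q2 i \<and> Q2 (Suc i))" using E12[OF i] E1 E2 by auto
      have "i \<noteq> 0" using nE E12[OF i] ends(1,2) by metis
      moreover have "Suc (Suc i) \<noteq> length xs"
      proof
        assume "Suc (Suc i) = length xs"
        then have "length xs - 1 = Suc i" by simp
        then show False using nE E12[OF i] ends(3,4) by metis
      qed
      ultimately have k: "0 < i" "Suc i < length xs" "0 < Suc i" "Suc (Suc i) < length xs"
        using E12[OF i] by auto
      have R: "R (xs ! i) (xs ! Suc i)" using k by (simp add: nth_adj)
      have "Q1 i \<and> Q2 (Suc i) \<or> Q1 (Suc i) \<and> Q2 i" using nE E12[OF i] by blast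
      then show False using mixed[OF k R] mixed[OF k(3,4,1,2) sym[OF R]] unfolding Q1_def Q2_def by blast
    qed
  qed
  \<comment> \<open>Both ends of a common edge would be \<open>X\<close>-complete, hence ends of the
    path, which has at least four vertices.\<close>
  have "E (X - {x1}) \<inter> E (X - {x2}) = {}"
  proof (rule ccontr)
    assume "\<not> ?thesis"
    then obtain i where i: "Suc i < length xs" "Q1 i" "Q2 i" "Q1 (Suc i)" "Q2 (Suc i)"
      using E1 E2 by blast
    then show False using both[of i] both[of "Suc i"] len by auto
  qed
  moreover have "finite (E S)" for S
    by (rule finite_subset[of _ "{..<length xs}"]) (auto simp: E_def)
  ultimately have "card (E (X - {x1, x2})) = card (E (X - {x1})) + card (E (X - {x2}))"
    unfolding split by (simp add: card_Un_disjoint)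
  moreover have "odd (card (E (X - {x1, x2})))" "odd (card (E (X - {x1})))" "odd (card (E (X - {x2})))"
    unfolding E_def by (rule IH; use c Y x ne in blast)+
  ultimately show False by simp
qed

text \<open>\<open>conn_trichotomy\<close> in the complement leaves a stable set, an antipath whose
  single interior vertex contradicts \<open>noncut_adj_even\<close>, or the situation of
  \<open>leaves_False\<close>.\<close>

lemma contradiction: False
  using finX connX
proof (cases rule: co.conn_trichotomy)
  case complete
  then show ?thesis by (rule stable_False)
next
  case (cherry a b c)
  have ab: "R a b" using cherry by (auto simp: coadj_def)
  have "ind_path (coadj R) (a # [c] @ [b])" using co.ind_path_three cherry by simp
  moreover have "set [c] \<subseteq> X - {a, b}" using cherry by (auto simp: coadj_def)
  ultimately have "even (length [c])" using noncut_adj_even[of a b "[c]"] cherry ab by blast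
  then show ?thesis by simp
next
  case (leaves a b)
  then show ?thesis using leaves_False[of a b] by (auto simp: coadj_def)
qed

end

text \<open>Induction on \<open>X\<close>, with the path cut at its \<open>X\<close>-complete
  vertices. A segment with an odd number of edges other than 1 would be an
  \<open>rr_counterexample\<close>, so \<open>segment_parity\<close> applies.
  \<open>even (length xs)\<close> counts vertices: the number of edges is odd.\<close>

theorem (in berge_adjacency) odd_complete_edges:
  assumes "finite X" "X \<noteq> {}" "conn (coadj R) X" "A \<inter> X = {}" "balanced_pair R A X"
    and "ind_path R xs" "even (length xs)"
    and "\<And>k. 0 < k \<Longrightarrow> Suc k < length xs \<Longrightarrow> xs ! k \<in> A"
    and "\<And>x. x \<in> X \<Longrightarrow> R (hd xs) x" "\<And>x. x \<in> X \<Longrightarrow> R (last xs) x"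
  shows "odd (card {i. Suc i < length xs \<and> (\<forall>x\<in>X. R (xs ! i) x \<and> R (xs ! Suc i) x)})"
  using assms
proof (induction X arbitrary: xs rule: finite_psubset_induct)
  case (psubset X)
  have ne: "xs \<noteq> []" using psubset.prems(5) unfolding ind_path_def by blast
  define n where "n = length xs - 1"
  have n: "length xs = Suc n" "odd n" using ne psubset.prems(6) unfolding n_def by auto
  define M where "M = {k. k \<le> n \<and> (\<forall>x\<in>X. R (xs ! k) x)}"
  have M: "0 \<in> M" "n \<in> M"
    using psubset.prems(8,9) ne n unfolding M_def by (auto simp: hd_conv_nth last_conv_nth)
  have "odd (card {i. i < n \<and> i \<in> M \<and> Suc i \<in> M}) \<longleftrightarrow> odd n"
  proof (rule segment_parity[OF M])
    fix i j assume ij: "i \<in> M" "j \<in> M" "i < j" "j \<le> n" "odd (j - i)"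
      and gap: "\<And>k. i < k \<Longrightarrow> k < j \<Longrightarrow> k \<notin> M"
    show "j = Suc i"
    proof (rule ccontr)
      assume "j \<noteq> Suc i"
      then have "j - i \<noteq> 1" using ij(3) by linarith
      then have ji: "j - i \<ge> 3" using ij(5) by presburger
      define zs where "zs = take (Suc (j - i)) (drop i xs)"
      have z: "length zs = Suc (j - i)" "\<And>k. k \<le> j - i \<Longrightarrow> zs ! k = xs ! (i + k)"
        using ij n unfolding zs_def by auto
      have zp: "ind_path R zs" unfolding zs_def by (rule ind_path_segment) (use psubset.prems(5) ij n in auto)
      have zA: "zs ! k \<in> A" if "0 < k" "Suc k < length zs" for k
        using that z psubset.prems(7)[of "i + k"] ij n by auto
      have z0: "\<forall>x\<in>X. R (zs ! 0) x" "\<forall>x\<in>X. R (zs ! (j - i)) x" using z ij by (auto simp: M_def)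
      have "rr_counterexample R A X zs"
      proof unfold_locales
        show "length zs \<ge> 4" using z(1) ji by simp
        show "even (length zs)" using z(1) ij(5) by simp
        show "\<exists>x\<in>X. \<not> R (zs ! k) x" if "0 < k" "Suc k < length zs" for k
          using gap[of "i + k"] that z ij n by (auto simp: M_def)
        show "R (zs ! 0) x" "R (zs ! (length zs - 1)) x" if "x \<in> X" for x
          using z0 that z(1) by auto
        \<comment> \<open>The ends of \<open>zs\<close> are complete to \<open>X\<close>, hence to
          \<open>Y\<close>, so the induction hypothesis applies to the segment itself.\<close>
        fix Y assume Y: "Y \<subset> X" "Y \<noteq> {}" "conn (coadj R) Y"
        show "odd (card {i. Suc i < length zs \<and> (\<forall>y\<in>Y. R (zs ! i) y \<and> R (zs ! Suc i) y)})"
        proof (rule psubset.IH[OF Y])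
          show "A \<inter> Y = {}" using psubset.prems(3) Y(1) by blast
          show "balanced_pair R A Y" using balanced_pair_mono[OF psubset.prems(4)] Y(1) by blast
          show "even (length zs)" using z(1) ij(5) by simp
          have "zs \<noteq> []" using z(1) by auto
          then have "hd zs = zs ! 0" "last zs = zs ! (j - i)"
            using z(1) by (simp_all add: hd_conv_nth last_conv_nth)
          then show "\<And>x. x \<in> Y \<Longrightarrow> R (hd zs) x" "\<And>x. x \<in> Y \<Longrightarrow> R (last zs) x" using z0 Y(1) by auto
        qed (use zp zA in auto)
      qed (use psubset zp zA in auto)
      then show False by (rule rr_counterexample.contradiction)
    qed
  qed
  moreover have "{i. i < n \<and> i \<in> M \<and> Suc i \<in> M} =
      {i. Suc i < length xs \<and> (\<forall>x\<in>X. R (xs ! i) x \<and> R (xs ! Suc i) x)}"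
    using n unfolding M_def by auto
  ultimately show ?case using n(2) by simp
qed

section \<open>Balanced pairs\<close>

context berge_adjacency
begin

text \<open>Any two vertices of \<open>B\<close> have the common neighbour \<open>v\<close>, which
  is nonadjacent to the interior of a path through \<open>A\<close>. In the complement
  \<open>A\<close> and \<open>B\<close> exchange roles.\<close>

lemma balanced_pair_vertex:
  assumes "v \<notin> A" "\<forall>b\<in>B. R v b" "\<forall>a\<in>A. \<not> R v a"
  shows "balanced_pair R A B"
proof -
  interpret co: berge_adjacency "coadj R" by (rule berge_adjacency_coadj)
  have vB: "v \<notin> B" using assms(2) irrefl by blast
  have "odd (length ys)"
    if p: "u \<in> B" "w \<in> B" "ind_path R (u # ys @ [w])" "\<not> R u w" "set ys \<subseteq> A" for u w ys
  proof (rule odd_path_common_neighbour[OF p(3,4)])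
    show "R u v" "R w v" using p assms(2) sym by blast+
    show "y \<noteq> v \<and> \<not> R y v" if "y \<in> set ys" for y using that p(5) assms sym by blast
  qed
  moreover have "odd (length ys)"
    if p: "u \<in> A" "w \<in> A" "ind_path (coadj R) (u # ys @ [w])" "\<not> coadj R u w" "set ys \<subseteq> B" for u w ys
  proof (rule co.odd_path_common_neighbour[OF p(3,4)])
    show "coadj R u v" "coadj R w v" using p assms sym unfolding coadj_def by blast+
    show "y \<noteq> v \<and> \<not> coadj R y v" if "y \<in> set ys" for y
      using that p(5) assms(2) vB sym unfolding coadj_def by blast
  qed
  ultimately show ?thesis unfolding balanced_pair_def even_paths_def by blast
qed

text \<open>An odd path through \<open>A\<close> between nonadjacent vertices of \<open>C\<close>
  has \<open>B\<close>-complete ends, hence a \<open>B\<close>-complete edge, and one of its ends is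
  in \<open>A\<close>, against \<open>nc\<close>. An antipath through \<open>C\<close> forms an
  antihole with an antipath through \<open>B\<close> between the same ends, so both interiors are
  odd.\<close>

lemma balanced_pair_anticonnected:
  assumes B: "finite B" "B \<noteq> {}" "conn (coadj R) B" and disj: "A \<inter> B = {}"
    and bal: "balanced_pair R A B" and nc: "\<forall>a\<in>A. \<exists>b\<in>B. \<not> R a b"
    and C: "\<forall>b\<in>B. \<forall>c\<in>C. R b c"
  shows "balanced_pair R A C"
proof -
  interpret co: berge_adjacency "coadj R" by (rule berge_adjacency_coadj)
  have "odd (length ys)"
    if p: "u \<in> C" "w \<in> C" "ind_path R (u # ys @ [w])" "\<not> R u w" "set ys \<subseteq> A" for u w ys
  proof (rule ccontr)
    assume even: "\<not> ?thesis"
    let ?xs = "u # ys @ [w]"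
    have inA: "?xs ! k \<in> A" if "0 < k" "Suc k < length ?xs" for k
      using that p(5) by (cases k) (auto simp: nth_append)
    have "odd (card {i. Suc i < length ?xs \<and> (\<forall>x\<in>B. R (?xs ! i) x \<and> R (?xs ! Suc i) x)})"
    proof (rule odd_complete_edges[OF B disj bal p(3) _ inA])
      show "even (length ?xs)" using even by simp
      show "R (hd ?xs) x" "R (last ?xs) x" if "x \<in> B" for x
        using that p(1,2) C sym by simp_all
    qed
    then have "{i. Suc i < length ?xs \<and> (\<forall>x\<in>B. R (?xs ! i) x \<and> R (?xs ! Suc i) x)} \<noteq> {}" by (metis card.empty even_zero)
    then obtain i where i: "Suc i < length ?xs" "\<forall>x\<in>B. R (?xs ! i) x" "\<forall>x\<in>B. R (?xs ! Suc i) x"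
      by blast
    have "ys \<noteq> []" using p(3,4) ind_path_pair[of R u w] by auto
    then have "length ?xs > 2" by simp
    then show False using i inA[of i] inA[of "Suc i"] nc by (cases "i = 0") auto
  qed
  moreover have "odd (length ys)"
    if p: "u \<in> A" "w \<in> A" "ind_path (coadj R) (u # ys @ [w])" "\<not> coadj R u w" "set ys \<subseteq> C" for u w ys
  proof -
    obtain x y where xy: "x \<in> B" "\<not> R u x" "y \<in> B" "\<not> R w y" using nc p by blast
    have uw: "u \<notin> B" "w \<notin> B" using p disj by auto
    have "u \<noteq> w" using p(3) by (auto dest: ind_path_distinct)
    moreover have "coadj R u x" "coadj R w y" using xy uw by (auto simp: coadj_def)
    ultimately obtain zs where zs: "ind_path (coadj R) (u # zs @ [w])" "set zs \<subseteq> B"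
      using co.ind_path_through[OF B(3) uw] xy by metis
    have "odd (length zs)"
      using bal even_pathsD[OF _ zs(1) p(1,2,4) zs(2)] unfolding balanced_pair_def by blast
    moreover have "even (length ys + length zs)"
    proof (rule co.even_two_paths[OF p(3) zs(1) p(4)])
      fix y z assume "y \<in> set ys" "z \<in> set zs"
      then have "R z y" using p(5) zs(2) C by blast
      then show "y \<noteq> z \<and> \<not> coadj R y z" using sym irrefl by (auto simp: coadj_def)
    qed
    ultimately show ?thesis by simp
  qed
  ultimately show ?thesis unfolding balanced_pair_def even_paths_def by blast
qed

lemma balanced_pair_connected:
  assumes "finite A" "A \<noteq> {}" "conn R A" "A \<inter> B = {}"
    and "balanced_pair R A B" "\<forall>b\<in>B. \<exists>a\<in>A. R b a"
    and "\<forall>a\<in>A. \<forall>c\<in>C. a \<noteq> c \<and> \<not> R a c"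
  shows "balanced_pair R C B"
proof -
  interpret co: berge_adjacency "coadj R" by (rule berge_adjacency_coadj)
  have "balanced_pair (coadj R) B C"
    by (rule co.balanced_pair_anticonnected[of A B C])
      (use assms in \<open>auto simp: coadj_coadj_eq balanced_pair_coadj, auto simp: coadj_def\<close>)
  then show ?thesis by (simp add: balanced_pair_coadj)
qed

text \<open>The interior of a path is connected, so it lies in \<open>A\<close> or in
  \<open>C\<close>; the ends of the antipaths in question are adjacent, so they lie on one side as
  well.\<close>

lemma balanced_pair_Un_left:
  assumes "balanced_pair R A B" "balanced_pair R C B" "\<forall>a\<in>A. \<forall>c\<in>C. a \<noteq> c \<and> \<not> R a c"
  shows "balanced_pair R (A \<union> C) B"
proof -
  have even: "even_paths R A B" "even_paths R C B" "even_paths (coadj R) B A" "even_paths (coadj R) B C"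
    using assms unfolding balanced_pair_def by blast+
  have "odd (length ys)"
    if p: "u \<in> B" "w \<in> B" "ind_path R (u # ys @ [w])" "\<not> R u w" "set ys \<subseteq> A \<union> C" for u w ys
  proof -
    have "ys \<noteq> []" using p(3,4) ind_path_pair[of R u w] by auto
    then have "ind_path R ys"
      using ind_path_prefix[OF ind_path_suffix[of R "[u]" "ys @ [w]"]] p(3) \<open>ys \<noteq> []\<close> by simp
    then have "conn R (set ys)" by (rule conn_set_ind_path)
    then have "set ys \<subseteq> A \<or> set ys \<subseteq> C"
      using conn_cross_edge[of "set ys" "set ys \<inter> A" "set ys \<inter> C"] p(5) assms(3) by blast
    then show ?thesis using even_pathsD[OF even(1)] even_pathsD[OF even(2)] p by blast
  qed
  moreover have "odd (length ys)"
    if p: "u \<in> A \<union> C" "w \<in> A \<union> C" "ind_path (coadj R) (u # ys @ [w])" "\<not> coadj R u w" "set ys \<subseteq> B" for u w ys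
  proof -
    have "u \<noteq> w" using p(3) by (auto dest: ind_path_distinct)
    then have "R u w" using p(4) by (auto simp: coadj_def)
    then have "u \<in> A \<and> w \<in> A \<or> u \<in> C \<and> w \<in> C" using p(1,2) assms(3) sym by blast
    then show ?thesis using even_pathsD[OF even(3)] even_pathsD[OF even(4)] p by blast
  qed
  ultimately show ?thesis unfolding balanced_pair_def even_paths_def by blast
qed

lemma balanced_pair_Un_right:
  assumes "balanced_pair R A B" "balanced_pair R A C" "\<forall>b\<in>B. \<forall>c\<in>C. R b c"
  shows "balanced_pair R A (B \<union> C)"
proof -
  interpret co: berge_adjacency "coadj R" by (rule berge_adjacency_coadj)
  have "\<forall>b\<in>B. \<forall>c\<in>C. b \<noteq> c \<and> \<not> coadj R b c" using assms(3) irrefl by (auto simp: coadj_def)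
  then have "balanced_pair (coadj R) (B \<union> C) A"
    using assms(1,2) by (intro co.balanced_pair_Un_left) (simp_all add: balanced_pair_coadj)
  then show ?thesis by (simp add: balanced_pair_coadj)
qed

lemma balanced_pair_singleton_left: "balanced_pair R {a} B"
proof -
  have "odd (length ys)"
    if p: "ind_path R (u # ys @ [w])" "\<not> R u w" "set ys \<subseteq> {a}" for u w ys
  proof -
    have "ys \<noteq> []" using p ind_path_pair[of R u w] by auto
    moreover have "card (set ys) = length ys" using ind_path_distinct[OF p(1)] by (simp add: distinct_card)
    moreover have "card (set ys) \<le> 1" using card_mono[OF _ p(3)] by simp
    ultimately have "length ys = 1" by (cases ys) auto
    then show ?thesis by simp
  qed
  moreover have False if "u \<in> {a}" "w \<in> {a}" "ind_path (coadj R) (u # ys @ [w])" for u w ys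
    using that by (auto dest: ind_path_distinct)
  ultimately show ?thesis unfolding balanced_pair_def even_paths_def by blast
qed

lemma balanced_pair_singleton_right: "balanced_pair R A {b}"
proof -
  interpret co: berge_adjacency "coadj R" by (rule berge_adjacency_coadj)
  show ?thesis using co.balanced_pair_singleton_left by (simp add: balanced_pair_coadj)
qed

text \<open>A vertex of \<open>Z\<close> inside a path is adjacent to both ends, so it is the whole
  interior. An antipath with nonempty interior in \<open>B\<close> has no end in
  \<open>Z\<close>.\<close>

lemma balanced_pair_add_complete:
  assumes "balanced_pair R A B" "\<forall>z\<in>Z. \<forall>b\<in>B. R z b"
  shows "balanced_pair R (A \<union> Z) B"
proof -
  have even: "even_paths R A B" "even_paths (coadj R) B A"
    using assms unfolding balanced_pair_def by blast+
  have "odd (length ys)"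
    if p: "u \<in> B" "w \<in> B" "ind_path R (u # ys @ [w])" "\<not> R u w" "set ys \<subseteq> A \<union> Z" for u w ys
  proof (cases "set ys \<subseteq> A")
    case True
    then show ?thesis using even_pathsD[OF even(1)] p by blast
  next
    case False
    then obtain z where "z \<in> set ys" "z \<in> Z" using p(5) by blast
    then obtain k where k: "k < length ys" "ys ! k \<in> Z" by (auto simp: in_set_conv_nth)
    then have "R (ys ! k) u" "R (ys ! k) w" using assms(2) p by blast+
    then have "k = 0" "Suc k = length ys"
      using ind_path_iff_nth[OF p(3), of "Suc k" 0] ind_path_iff_nth[OF p(3), of "Suc k" "Suc (length ys)"] k(1)
      by (auto simp: nth_append)
    then have "length ys = 1" by simp
    then show ?thesis by simp
  qed
  moreover have "odd (length ys)"
    if p: "u \<in> A \<union> Z" "w \<in> A \<union> Z" "ind_path (coadj R) (u # ys @ [w])" "\<not> coadj R u w" "set ys \<subseteq> B" for u w ys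
  proof -
    have ne: "ys \<noteq> []" using p(3,4) ind_path_pair[of "coadj R" u w] by auto
    have "coadj R u (ys ! 0)" "coadj R w (ys ! (length ys - 1))"
      using ind_path_iff_nth[OF p(3), of 0 1]
        ind_path_iff_nth[OF p(3), of "Suc (length ys)" "length ys"] ne
      by (auto simp: nth_append nth_Cons')
    moreover have "ys ! 0 \<in> B" "ys ! (length ys - 1) \<in> B" using ne p(5) by (auto simp: subset_iff)
    ultimately have "u \<notin> Z" "w \<notin> Z" using assms(2) by (auto simp: coadj_def)
    then show ?thesis using even_pathsD[OF even(2)] p by blast
  qed
  ultimately show ?thesis unfolding balanced_pair_def even_paths_def by blast
qed

lemma not_connI: "S \<subseteq> X \<Longrightarrow> S \<noteq> {} \<Longrightarrow> S \<noteq> X \<Longrightarrow> \<forall>s\<in>S. \<forall>t\<in>X - S. \<not> R s t \<Longrightarrow> \<not> conn R X"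
  using conn_cross_edge[of X S "X - S"] by auto

lemma component_of_disjoint:
  assumes "component_of R A C" "component_of R A D" "C \<noteq> D"
  shows "C \<inter> D = {}"
proof (rule ccontr)
  assume ne: "C \<inter> D \<noteq> {}"
  have "conn R (C \<union> D)"
    by (rule conn_Un[OF _ _ ne]) (use assms in \<open>auto simp: component_of_def\<close>)
  moreover have "C \<union> D \<subseteq> A" using assms(1,2) by (simp add: component_of_def)
  ultimately have eq: "C \<union> D = E" if "component_of R A E" "E \<subseteq> C \<union> D" for E
    using that by (simp add: component_of_def)
  have "C \<union> D = C" by (rule eq[OF assms(1)]) simp
  moreover have "C \<union> D = D" by (rule eq[OF assms(2)]) simp
  ultimately show False using assms(3) by simp
qed

lemma skew_partition_coadj: "skew_partition V (coadj R) B A \<longleftrightarrow> skew_partition V R A B"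
  unfolding skew_partition_def coadj_coadj_eq by blast

section \<open>Balanced skew partitions\<close>

text \<open>Let \<open>N\<close> be the neighbourhood of \<open>a\<close>. If
  \<open>N \<subseteq> B'\<close> and \<open>B' \<subseteq> B\<close>, then \<open>a\<close> is
  isolated in \<open>V - B'\<close> and makes \<open>(V - B', N)\<close> balanced. It remains to
  choose \<open>B'\<close> not anticonnected: \<open>N\<close> if possible, otherwise
  \<open>N\<close> with a vertex complete to it, or two adjacent vertices if \<open>N\<close> is
  empty.\<close>

lemma balanced_skew_partition_if_isolated:
  assumes skew: "skew_partition V R A B" and a: "a \<in> A" "\<forall>x\<in>A. \<not> R a x"
  shows "\<exists>A B. skew_partition V R A B \<and> balanced_pair R A B"
proof -
  interpret co: berge_adjacency "coadj R" by (rule berge_adjacency_coadj)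
  have V: "A \<union> B = V" "A \<inter> B = {}" "\<not> conn R A" "\<not> conn (coadj R) B"
    using skew unfolding skew_partition_def by blast+
  obtain a' where a': "a' \<in> A" "a' \<noteq> a" using V(3) conn_singleton[of a] a(1) by (metis is_singletonI' is_singletonE empty_iff singletonD)
  obtain S T where ST: "S \<union> T = B" "S \<inter> T = {}" "S \<noteq> {}" "T \<noteq> {}" "\<forall>s\<in>S. \<forall>t\<in>T. \<not> coadj R s t"
    using co.not_conn_split[OF V(4)] by blast
  have STR: "R s t \<and> R t s" if "s \<in> S" "t \<in> T" for s t
  proof -
    have "s \<noteq> t" using that ST(2) by blast
    then have "R s t" using that ST(5) by (auto simp: coadj_def)
    then show ?thesis using sym by blast
  qed
  define N where "N = {x \<in> V. R a x}"
  have NB: "N \<subseteq> B" using a(2) V(1) unfolding N_def by blast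
  have nc: "\<not> conn R (V - B')" if "N \<subseteq> B'" "B' \<subseteq> B" for B'
  proof (rule not_connI[of "{a}"])
    show "{a} \<subseteq> V - B'" "{a} \<noteq> V - B'" using that a a' V(1,2) by blast+
    show "\<forall>s\<in>{a}. \<forall>t\<in>V - B' - {a}. \<not> R s t" using that unfolding N_def by blast
  qed simp
  have balN: "balanced_pair R (V - B') N" if "N \<subseteq> B'" "B' \<subseteq> B" for B'
  proof -
    \<comment> \<open>\<open>a\<close> is complete to \<open>N\<close> and has no neighbour in
      \<open>V - B'\<close>; being isolated there, it can be added back as a singleton.\<close>
    have "balanced_pair R (V - B' - {a}) N"
      by (rule balanced_pair_vertex[of a]) (use that in \<open>auto simp: N_def\<close>)
    then have "balanced_pair R ((V - B' - {a}) \<union> {a}) N"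
      by (rule balanced_pair_Un_left[OF _ balanced_pair_singleton_left])
        (use that sym in \<open>auto simp: N_def\<close>)
    moreover have "(V - B' - {a}) \<union> {a} = V - B'" using that a(1) V(1,2) by blast
    ultimately show ?thesis by simp
  qed
  have skewI: "skew_partition V R (V - B') B'" if "N \<subseteq> B'" "B' \<subseteq> B" "\<not> conn (coadj R) B'" for B'
    using nc that V(1) unfolding skew_partition_def by blast
  consider "N = {}" | "N \<noteq> {}" "\<not> conn (coadj R) N" | "N \<noteq> {}" "conn (coadj R) N" by blast
  then show ?thesis
  proof cases
    case 1
    obtain s t where st: "s \<in> S" "t \<in> T" using ST by blast
    have "balanced_pair R (V - ({s} \<union> {t})) ({s} \<union> {t})"
      using STR[OF st] by (intro balanced_pair_Un_right balanced_pair_singleton_right) auto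
    moreover have "\<not> conn (coadj R) ({s} \<union> {t})"
      by (rule co.not_connI[of "{s}"]) (use STR[OF st] st ST(2) in \<open>auto simp: coadj_def\<close>)
    moreover have "N \<subseteq> {s} \<union> {t}" "{s} \<union> {t} \<subseteq> B" using 1 st ST(1) by auto
    ultimately show ?thesis using skewI[of "{s} \<union> {t}"] by blast
  next
    case 2
    then show ?thesis using skewI[of N] balN[of N] NB by blast
  next
    case 3
    \<comment> \<open>\<open>N\<close> is anticonnected and cannot meet both sides, so any vertex of
      the other side is complete to it.\<close>
    have "N \<subseteq> S \<or> N \<subseteq> T"
      using co.conn_cross_edge[OF 3(2), of "N \<inter> S" "N \<inter> T"] NB ST(1,2,5) by blast
    then obtain b where b: "b \<in> B" "b \<notin> N" "\<forall>x\<in>N. R b x"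
      using ST STR by (metis Un_iff disjoint_iff ex_in_conv subset_iff)
    have sub: "N \<subseteq> {b} \<union> N" "{b} \<union> N \<subseteq> B" using b(1) NB by auto
    have "balanced_pair R (V - ({b} \<union> N)) ({b} \<union> N)"
      using b(3) by (intro balanced_pair_Un_right balanced_pair_singleton_right balN sub) auto
    moreover have "\<not> conn (coadj R) ({b} \<union> N)"
      by (rule co.not_connI[of "{b}"]) (use b 3 in \<open>auto simp: coadj_def\<close>)
    ultimately show ?thesis using skewI[OF sub] by blast
  qed
qed

lemma balanced_skew_partition_if_missed_component:
  assumes "finite V" "skew_partition V R A0 B0" "b0 \<in> B0" "component_of R A0 C0" "\<forall>c\<in>C0. \<not> R b0 c"
  shows "\<exists>A B. skew_partition V R A B \<and> balanced_pair R A B"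
proof (rule ccontr)
  assume contra: "\<not> ?thesis"
  interpret co: berge_adjacency "coadj R" by (rule berge_adjacency_coadj)
  \<comment> \<open>Isolated vertices would give a balanced skew partition. The neighbours obtained
    here, and dually the nonneighbours, keep both sides split when a vertex is moved.\<close>
  have nbr: "\<exists>x\<in>A. R a x" if "skew_partition V R A B" "a \<in> A" for A B a
    using balanced_skew_partition_if_isolated[OF that] contra by blast
  have non_nbr: "\<exists>x\<in>B. coadj R b x" if "skew_partition V R A B" "b \<in> B" for A B b
  proof (rule ccontr)
    assume "\<not> ?thesis"
    then have "\<exists>A B. skew_partition V (coadj R) B A \<and> balanced_pair (coadj R) B A"
      using co.balanced_skew_partition_if_isolated[of V B A b] that by (auto simp: skew_partition_coadj)
    then show False using contra by (auto simp: skew_partition_coadj balanced_pair_coadj)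
  qed
  define config where "config = (\<lambda>(A, B, C, K). skew_partition V R A B \<and> component_of R A C \<and>
    component_of (coadj R) B K \<and> (\<exists>b\<in>K. \<forall>c\<in>C. \<not> R b c))"
  \<comment> \<open>\<open>|B| - 2|K|\<close>, shifted by \<open>2|V|\<close> to avoid truncation\<close>
  define cost :: "'a set \<times> 'a set \<times> 'a set \<times> 'a set \<Rightarrow> nat"
    where "cost = (\<lambda>(A, B, C, K). card B + 2 * (card V - card K))"
  have "finite B0" using assms(1,2) finite_subset unfolding skew_partition_def by blast
  then obtain K0 where "component_of (coadj R) B0 K0" "{b0} \<subseteq> K0"
    using co.component_of_superset[of B0 "{b0}"] assms(3) co.conn_singleton by blast
  then have "config (A0, B0, C0, K0)" using assms unfolding config_def by auto
  then obtain m where m: "config m" "\<And>m'. config m' \<Longrightarrow> cost m \<le> cost m'"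
    using ex_has_least_nat[of config _ cost] by blast
  obtain A B C K where "m = (A, B, C, K)" by (cases m)
  note m = m[unfolded this]
  have skew: "skew_partition V R A B" and C: "component_of R A C" and K: "component_of (coadj R) B K"
    using m(1) unfolding config_def by auto
  obtain b where b: "b \<in> K" "\<forall>c\<in>C. \<not> R b c" using m(1) unfolding config_def by auto
  have V: "A \<union> B = V" "A \<inter> B = {}" "\<not> conn R A" "\<not> conn (coadj R) B"
    using skew unfolding skew_partition_def by blast+
  have fin: "finite A" "finite B" using V(1) assms(1) by auto
  have Kp: "K \<noteq> {}" "K \<subseteq> B" "conn (coadj R) K" "\<forall>x\<in>K. \<forall>y\<in>B - K. \<not> coadj R x y"
    using K unfolding co.component_of_iff by auto
  have Cp: "C \<noteq> {}" "C \<subseteq> A" "conn R C" "\<forall>x\<in>C. \<forall>y\<in>A - C. \<not> R x y"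
    using C unfolding component_of_iff by auto
  have KF: "\<forall>k\<in>K. \<forall>f\<in>B - K. R k f" 
  proof (intro ballI)
    fix k f assume kf: "k \<in> K" "f \<in> B - K"
    then have "k \<noteq> f" by blast
    then show "R k f" using kf Kp(4) by (auto simp: coadj_def)
  qed
  have CD: "\<forall>c\<in>C. \<forall>d\<in>A - C. c \<noteq> d \<and> \<not> R c d" using Cp(4) by auto
  have ne: "A - C \<noteq> {}" "B - K \<noteq> {}" using V(3,4) Cp Kp by (metis Diff_eq_empty_iff subset_antisym)+
  then obtain f where "f \<in> B - K" by blast
  then obtain L where L: "component_of (coadj R) B L" "{f} \<subseteq> L"
    using co.component_of_superset[OF fin(2), of "{f}"] co.conn_singleton by blast
  have "L \<noteq> K" using L(2) \<open>f \<in> B - K\<close> by blast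
  have LK: "L \<inter> K = {}" by (rule co.component_of_disjoint[OF L(1) K \<open>L \<noteq> K\<close>])
  have Lp: "L \<noteq> {}" "L \<subseteq> B" "conn (coadj R) L" "\<forall>x\<in>L. \<forall>y\<in>B - L. \<not> coadj R x y"
    using L unfolding co.component_of_iff by auto
  then have LF: "L \<subseteq> B - K" using LK by blast

  \<comment> \<open>Moving \<open>v\<close> to \<open>B\<close> adds 1 to \<open>card B\<close> and
    at least 1 to the size of the anticomponent, as \<open>v\<close> joins that of \<open>K\<close>;
    so the cost drops. \<open>C'\<close> is general because a second component of \<open>A\<close>
    takes the place of \<open>C\<close> later.\<close>
  have complete: "\<forall>k\<in>K. R v k"
    if conf: "config (A, B, C', K)" "cost (A, B, C', K) = cost (A, B, C, K)"
      and v: "v \<in> A - C'" "\<forall>l\<in>L. R v l" for C' v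
  proof (rule ccontr)
    assume "\<not> ?thesis"
    then obtain k where k: "k \<in> K" "\<not> R v k" by blast
    have C': "component_of R A C'" using conf(1) unfolding config_def by auto
    then have C'p: "C' \<noteq> {}" "C' \<subseteq> A" "conn R C'" "\<forall>x\<in>C'. \<forall>y\<in>A - C'. \<not> R x y"
      unfolding component_of_iff by auto
    have vB: "v \<notin> B" "v \<in> V" using v V by auto
    then have "coadj R v k" using k Kp(2) by (auto simp: coadj_def)
    then have "conn (coadj R) (insert v K)" by (rule co.conn_insert[OF Kp(3) k(1)])
    then obtain K' where K': "component_of (coadj R) (insert v B) K'" "insert v K \<subseteq> K'"
      using co.component_of_superset[of "insert v B" "insert v K"] fin(2) Kp(2) by blast
    have K'B: "K' \<subseteq> insert v B" using K'(1) unfolding component_of_def by blast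
    have "\<not> conn R (A - {v})"
    proof (rule not_connI[of C'])
      \<comment> \<open>Like its neighbour \<open>v\<close>, the vertex \<open>y\<close> is outside
        \<open>C'\<close>, so \<open>C'\<close> is not all of \<open>A - {v}\<close>.\<close>
      obtain y where "y \<in> A" "R v y" using nbr[OF skew, of v] v by blast
      then have "y \<in> A - {v} - C'" using C'p(4) v(1) irrefl sym by blast
      then show "C' \<noteq> A - {v}" by blast
    qed (use C'p v(1) in auto)
    \<comment> \<open>\<open>v\<close> is complete to \<open>L\<close>, so \<open>L\<close> stays
      separated in the complement.\<close>
    moreover have "\<not> conn (coadj R) (insert v B)"
    proof (rule co.not_connI[of L])
      show "L \<noteq> insert v B" using vB(1) Lp(2) by blast
      show "\<forall>s\<in>L. \<forall>t\<in>insert v B - L. \<not> coadj R s t"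
        using Lp(4) v(2) sym by (auto simp: coadj_def)
    qed (use Lp in auto)
    moreover have "A - {v} \<union> insert v B = V" "(A - {v}) \<inter> insert v B = {}" using V v(1) by auto
    ultimately have "skew_partition V R (A - {v}) (insert v B)" unfolding skew_partition_def by blast
    moreover have "component_of R (A - {v}) C'" unfolding component_of_iff using C'p v(1) by auto
    moreover have "\<exists>b\<in>K'. \<forall>c\<in>C'. \<not> R b c" using conf(1) K'(2) unfolding config_def by auto
    ultimately have "config (A - {v}, insert v B, C', K')" using K'(1) unfolding config_def by auto
    then have "cost (A, B, C, K) \<le> cost (A - {v}, insert v B, C', K')" by (rule m(2))
    moreover have "card (insert v B) = Suc (card B)" using fin(2) vB(1) by simp
    moreover have "Suc (card K) \<le> card K'"
    proof -
      have "card (insert v K) \<le> card K'"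
        using K'(2) K'B fin(2) by (intro card_mono) (auto intro: finite_subset)
      moreover have "v \<notin> K" "finite K" using vB(1) Kp(2) fin(2) finite_subset by auto
      ultimately show ?thesis by simp
    qed
    moreover have "card K' \<le> card V" using K'B V(1) vB(2) assms(1) by (intro card_mono) auto
    ultimately show False unfolding cost_def by simp
  qed

  \<comment> \<open>A vertex \<open>f\<close> of \<open>B - K\<close> without neighbours in
    \<open>C\<close> could move to \<open>A\<close>: this keeps \<open>C\<close> and
    \<open>K\<close> and lowers \<open>card B\<close> by 1.\<close>
  have CF: "\<forall>f\<in>B - K. \<exists>c\<in>C. R f c"
  proof (rule ccontr)
    assume "\<not> ?thesis"
    then obtain f where f: "f \<in> B" "f \<notin> K" "\<forall>c\<in>C. \<not> R f c" by blast
    have fA: "f \<notin> A" using f(1) V(2) by blast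
    have "\<not> conn R (insert f A)"
      by (rule not_connI[of C]) (use Cp f(3) fA sym in auto)
    moreover have "\<not> conn (coadj R) (B - {f})"
    proof (rule co.not_connI[of K])
      \<comment> \<open>\<open>f\<close> is complete to \<open>K\<close>, so its nonneighbour
        \<open>y\<close> is outside \<open>K\<close> and \<open>B - {f}\<close> does not shrink to
        \<open>K\<close>.\<close>
      obtain y where "y \<in> B" "coadj R f y" using non_nbr[OF skew f(1)] by blast
      then have "y \<in> B - {f} - K" using KF f(1,2) sym by (auto simp: coadj_def)
      then show "K \<noteq> B - {f}" by blast
    qed (use Kp f in auto)
    moreover have "insert f A \<union> (B - {f}) = V" "insert f A \<inter> (B - {f}) = {}" using V f(1) by auto
    ultimately have "skew_partition V R (insert f A) (B - {f})" unfolding skew_partition_def by blast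
    moreover have "component_of R (insert f A) C" unfolding component_of_iff using Cp f(3) fA sym by auto
    moreover have "component_of (coadj R) (B - {f}) K" unfolding co.component_of_iff using Kp f(2) by auto
    ultimately have "config (insert f A, B - {f}, C, K)" using b unfolding config_def by auto
    then have "cost (A, B, C, K) \<le> cost (insert f A, B - {f}, C, K)" by (rule m(2))
    moreover have "card B > 0" using f(1) fin(2) by (auto simp: card_gt_0_iff)
    ultimately show False using f(1) fin(2) unfolding cost_def by simp
  qed

  have finCKL: "finite C" "finite K" "finite L" 
    using finite_subset[OF Cp(2) fin(1)] finite_subset[OF Kp(2) fin(2)] finite_subset[OF Lp(2) fin(2)]
    by blast+
  \<comment> \<open>By \<open>complete\<close>, a vertex of \<open>W\<close> with a nonneighbour in
    \<open>K\<close> has one in \<open>L\<close>, so balance passes from \<open>L\<close> to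
    \<open>K\<close> on these vertices; those complete to \<open>K\<close> are added
    afterwards.\<close>
  have bal_K: "balanced_pair R W K"
    if conf: "config (A, B, C', K)" "cost (A, B, C', K) = cost (A, B, C, K)"
      and W: "W \<subseteq> A - C'" "balanced_pair R W L" for C' W
  proof -
    let ?W = "{w \<in> W. \<exists>k\<in>K. \<not> R w k}"
    have "balanced_pair R ?W K"
    proof (rule balanced_pair_anticonnected[OF finCKL(3) Lp(1,3)])
      show "?W \<inter> L = {}" using W(1) Lp(2) V(2) by blast
      show "balanced_pair R ?W L" by (rule balanced_pair_mono[OF W(2)]) auto
      show "\<forall>a\<in>?W. \<exists>l\<in>L. \<not> R a l" using complete[OF conf] W(1) by blast
      show "\<forall>l\<in>L. \<forall>k\<in>K. R l k" using KF LF sym by blast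
    qed
    then have "balanced_pair R (?W \<union> {w \<in> W. \<forall>k\<in>K. R w k}) K"
      by (rule balanced_pair_add_complete) auto
    moreover have "?W \<union> {w \<in> W. \<forall>k\<in>K. R w k} = W" by blast
    ultimately show ?thesis by simp
  qed

  \<comment> \<open>\<open>b\<close> has no neighbour in \<open>C\<close> and is complete to
    \<open>B - K\<close>.\<close>
  have bC: "balanced_pair R C (B - K)"
    by (rule balanced_pair_vertex[of b]) (use b KF Kp(2) Cp(2) V(2) in auto)
  \<comment> \<open>The connected set \<open>C\<close> passes balance on to \<open>A - C\<close>,
    since by \<open>CF\<close> every vertex of \<open>B - K\<close> has a neighbour in
    \<open>C\<close>.\<close>
  have bD: "balanced_pair R (A - C) (B - K)"
    by (rule balanced_pair_connected[OF finCKL(1) Cp(1,3) _ bC CF CD]) (use Cp(2) V(2) in auto)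
  have DK: "balanced_pair R (A - C) K"
    by (rule bal_K[OF m(1) refl subset_refl balanced_pair_mono[OF bD subset_refl LF]])
  have CK: "balanced_pair R C K"
  proof -
    obtain d where "d \<in> A - C" using ne by blast
    then obtain D where D: "component_of R A D" "{d} \<subseteq> D"
      using component_of_superset[OF fin(1), of "{d}"] conn_singleton by blast
    have "D \<noteq> C" using D(2) \<open>d \<in> A - C\<close> by blast
    have DC: "D \<inter> C = {}" by (rule component_of_disjoint[OF D(1) C \<open>D \<noteq> C\<close>])
    have Dp: "D \<noteq> {}" "D \<subseteq> A" "conn R D" using D(1) unfolding component_of_def by auto
    \<comment> \<open>If every vertex of \<open>K\<close> has a neighbour in \<open>D\<close>,
      balance passes from \<open>D\<close> to \<open>C\<close>. Otherwise
      \<open>(A, B, D, K)\<close> is a configuration too, of the same cost because the cost ignores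
      the component, so \<open>bal_K\<close> applies with \<open>D\<close> in place of
      \<open>C\<close>.\<close>
    show ?thesis
    proof (cases "\<forall>k\<in>K. \<exists>d\<in>D. R k d")
      case True
      show ?thesis
      proof (rule balanced_pair_connected[OF _ Dp(1,3) _ _ True])
        show "finite D" using Dp(2) fin(1) finite_subset by blast
        show "D \<inter> K = {}" using Dp(2) Kp(2) V(2) by blast
        show "balanced_pair R D K" by (rule balanced_pair_mono[OF DK]) (use Dp(2) DC in auto)
        show "\<forall>a\<in>D. \<forall>c\<in>C. a \<noteq> c \<and> \<not> R a c" using CD Dp(2) DC sym by blast
      qed
    next
      case False
      then have "config (A, B, D, K)" using skew D(1) K unfolding config_def by auto
      moreover have "cost (A, B, D, K) = cost (A, B, C, K)" unfolding cost_def by simp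
      moreover have "C \<subseteq> A - D" using Cp(2) DC by blast
      moreover have "balanced_pair R C L" by (rule balanced_pair_mono[OF bC subset_refl LF])
      ultimately show ?thesis by (rule bal_K)
    qed
  qed
  have "balanced_pair R (C \<union> (A - C)) K" by (rule balanced_pair_Un_left[OF CK DK CD])
  moreover have "balanced_pair R (C \<union> (A - C)) (B - K)" by (rule balanced_pair_Un_left[OF bC bD CD])
  ultimately have "balanced_pair R (C \<union> (A - C)) (K \<union> (B - K))"
    by (rule balanced_pair_Un_right[OF _ _ KF])
  moreover have "C \<union> (A - C) = A" "K \<union> (B - K) = B" using Cp(2) Kp(2) by auto
  ultimately show False using contra skew by auto
qed

end

section \<open>From finite graphs to adjacency relations and back\<close>

lemma simple_graph_berge_adjacency:
  assumes G: "simple_graph V E" and "berge V E"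
  shows "berge_adjacency E"
proof
  show "E v u" if "E u v" for u v using that G unfolding simple_graph_def by blast
  show "\<not> E v v" for v using G unfolding simple_graph_def by blast
  have EV: "u \<in> V" if "E u v" for u v using that G unfolding simple_graph_def by blast
  show "even (length xs)" if h: "ind_hole E xs" for xs
  proof -
    have "E (xs ! i) (xs ! (Suc i mod length xs))" if "i < length xs" for i
    proof -
      have "Suc i mod length xs < length xs" using that by (intro mod_less_divisor) auto
      then show ?thesis using h that unfolding ind_hole_def by blast
    qed
    then have "xs ! i \<in> V" if "i < length xs" for i using EV that by blast
    then have "set xs \<subseteq> V" by (auto simp: in_set_conv_nth)
    then show ?thesis using h assms(2) unfolding berge_def by blast
  qed
  show "even (length xs)" if h: "ind_hole (coadj E) xs" for xs
  proof -
    let ?n = "length xs"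
    \<comment> \<open>\<open>j\<close> lies two places after \<open>i\<close> around the antihole.
      As the length is at least 4, the two vertices are not consecutive, hence adjacent in
      \<open>E\<close>, which puts \<open>xs ! i\<close> into \<open>V\<close>.\<close>
    have "E (xs ! i) (xs ! j)" if i: "i < ?n" and j: "j = (if Suc (Suc i) < ?n then Suc (Suc i) else Suc (Suc i) - ?n)" for i j
    proof -
      have n: "?n \<ge> 4" "distinct xs" using h unfolding ind_hole_def by auto
      have j: "j < ?n" "j \<noteq> i" "Suc i mod ?n \<noteq> j" "Suc j mod ?n \<noteq> i"
        using i j n(1) by (auto simp: Suc_mod_eq split: if_splits)
      then have "\<not> coadj E (xs ! i) (xs ! j)" using h i unfolding ind_hole_def by blast
      moreover have "xs ! i \<noteq> xs ! j" using j(1,2) i n(2) by (simp add: nth_eq_iff_index_eq)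
      ultimately show ?thesis by (simp add: coadj_def)
    qed
    then have "xs ! i \<in> V" if "i < length xs" for i using EV that by blast
    then have "set xs \<subseteq> V" by (auto simp: in_set_conv_nth)
    then show ?thesis using h assms(2) unfolding berge_def by blast
  qed
qed

lemma balanced_pair_imp_balanced:
  assumes "balanced_pair E A B"
  shows "balanced V E A B"
proof -
  have *: "\<not> (even_paths R A B \<and> ind_path R xs \<and> length xs \<ge> 2 \<and> hd xs \<in> B \<and> last xs \<in> B \<and>
      \<not> R (hd xs) (last xs) \<and> set (butlast (tl xs)) \<subseteq> A \<and> odd (length xs - 1))"
    for R :: "'a \<Rightarrow> 'a \<Rightarrow> bool" and A B xs
  proof
    assume h: "even_paths R A B \<and> ind_path R xs \<and> length xs \<ge> 2 \<and> hd xs \<in> B \<and> last xs \<in> B \<and>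
      \<not> R (hd xs) (last xs) \<and> set (butlast (tl xs)) \<subseteq> A \<and> odd (length xs - 1)"
    then obtain u ys w where xs: "xs = u # ys @ [w]"
      by (cases xs; cases "tl xs" rule: rev_cases) auto
    then show False using h even_pathsD[of R A B u ys w] by auto
  qed
  show ?thesis
    unfolding balanced_def
    using *[of E A B] *[of "coadj E" B A] assms unfolding balanced_pair_def coadj_def by blast
qed

theorem theorem4p2:
  fixes V :: "'a set" and E :: "'a \<Rightarrow> 'a \<Rightarrow> bool"
  assumes "simple_graph V E"
    and "berge V E"
    and "\<exists>A B. skew_partition V E A B \<and> loose V E A B"
  shows "\<exists>A B. skew_partition V E A B \<and> balanced V E A B"
proof -
  interpret berge_adjacency E by (rule simple_graph_berge_adjacency[OF assms(1,2)])
  interpret co: berge_adjacency "coadj E" by (rule berge_adjacency_coadj)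
  have fin: "finite V" using assms(1) unfolding simple_graph_def by blast
  obtain A B where AB: "skew_partition V E A B" "loose V E A B" using assms(3) by blast
  consider b C where "b \<in> B" "component_of E A C" "\<forall>c\<in>C. \<not> E b c"
    | a K where "a \<in> A" "component_of (coadj E) B K" "\<forall>k\<in>K. E a k"
    using AB(2) unfolding loose_def by blast
  then have "\<exists>A B. skew_partition V E A B \<and> balanced_pair E A B"
  proof cases
    case 1
    then show ?thesis using balanced_skew_partition_if_missed_component[OF fin AB(1)] by blast
  next
    case 2
    \<comment> \<open>The second kind of looseness is the first one in the complement, where
      \<open>A\<close> and \<open>B\<close> exchange roles.\<close>
    then have "\<forall>k\<in>K. \<not> coadj E a k" by (simp add: coadj_def)
    moreover have "skew_partition V (coadj E) B A" using AB(1) by (simp add: skew_partition_coadj)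
    ultimately have "\<exists>A B. skew_partition V (coadj E) B A \<and> balanced_pair (coadj E) B A"
      using co.balanced_skew_partition_if_missed_component[OF fin _ 2(1,2)] by blast
    then show ?thesis by (simp add: skew_partition_coadj balanced_pair_coadj)
  qed
  then show ?thesis using balanced_pair_imp_balanced by blast
qed

end
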